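(* Let $(E,\mathscr{T},\le)$ be a $T_2$-ordered space such that $(E,\mathscr{T})$ is second countable and locally compact. If $(E,\mathscr{T},\le)$ is $k$-preserving or compactly generated, then it is quasi-pseudo-metrizable. That is, there is a quasi-pseudo-metric $p:E\times E\to[0,+\infty)$ (actually an Albert's quasi-metric) such that $\mathscr{T}$ is the topology induced by the metric $p\vee p^{-1}$ and $G(\le)=\{(x,y):p(x,y)=0\}$.
   Context: $(E,\mathscr{T},\le)$ is $T_2$-ordered if $\le$ is a partial order (reflexive, transitive, antisymmetric) on the topological space $(E,\mathscr{T})$ with graph $G(\le)=\{(x,y):x\le y\}$ closed in $E\times E$. Locally compact means that each point has a compact neighborhood. Set $i(S)=\{y: x\le y \text{ for some } x\in S\}$, $d(S)=\{y: y\le x \text{ for some } x\in S\}$. The space is $k$-preserving if $d(K)\cap i(K)$ is compact for every compact $K\subset E$. It is compactly generated if there is a relation $R\subset G(\le)$ such that (i) for every compact set $K$ the set $\overline{R(K)}$ is compact, where $R(K)=\{y: (x,y)\in R \text{ for some } x\in K\}$, and (ii) $\le$ is the smallest closed preorder (reflexive transitive relation with closed graph) containing $R$. A quasi-pseudo-metric on $E$ is a function $p:E\times E\to[0,+\infty)$ with $p(x,x)=0$ and $p(x,z)\le p(x,y)+p(y,z)$ for all $x,y,z$. It is an Albert's quasi-metric if moreover $p(x,y)=p(y,x)=0$ iff $x=y$. The conjugate is $p^{-1}(x,y)=p(y,x)$, and $(p\vee p^{-1})(x,y)=\max\{p(x,y),p(y,x)\}$. *)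

theory Defs
  imports "HOL-Analysis.Analysis"
begin

text \<open>
  The space is an abstract topology \<open>T\<close> with point set \<open>topspace T\<close>, and the order is
  represented by its graph \<open>G \<subseteq> topspace T \<times> topspace T\<close>, so that
  \<open>(x, y) \<in> G\<close> means \<open>x \<le> y\<close>.
\<close>

definition closed_preorder :: "'a topology \<Rightarrow> ('a \<times> 'a) set \<Rightarrow> bool" where
  "closed_preorder T G \<longleftrightarrow> preorder_on (topspace T) G \<and> closedin (prod_topology T T) G"

definition T2_ordered :: "'a topology \<Rightarrow> ('a \<times> 'a) set \<Rightarrow> bool" where
  "T2_ordered T G \<longleftrightarrow> partial_order_on (topspace T) G \<and> closedin (prod_topology T T) G"

definition increasing_hull :: "('a \<times> 'a) set \<Rightarrow> 'a set \<Rightarrow> 'a set" where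
  "increasing_hull G S = {y. \<exists>x\<in>S. (x, y) \<in> G}"

definition decreasing_hull :: "('a \<times> 'a) set \<Rightarrow> 'a set \<Rightarrow> 'a set" where
  "decreasing_hull G S = {y. \<exists>x\<in>S. (y, x) \<in> G}"

definition k_preserving :: "'a topology \<Rightarrow> ('a \<times> 'a) set \<Rightarrow> bool" where
  "k_preserving T G \<longleftrightarrow>
     (\<forall>K. compactin T K \<longrightarrow> compactin T (decreasing_hull G K \<inter> increasing_hull G K))"

definition compactly_generated :: "'a topology \<Rightarrow> ('a \<times> 'a) set \<Rightarrow> bool" where
  "compactly_generated T G \<longleftrightarrow>
     (\<exists>R. R \<subseteq> G \<and>
          (\<forall>K. compactin T K \<longrightarrow> compactin T (T closure_of (R `` K))) \<and>
          closed_preorder T G \<and>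
          (\<forall>Q. closed_preorder T Q \<and> R \<subseteq> Q \<longrightarrow> G \<subseteq> Q))"

text \<open>
  As in the library locale \<open>Metric_space\<close>, nonnegativity is required on the whole type; this is
  only a convention on the irrelevant values off \<open>E\<close>.
\<close>

definition quasi_pseudo_metric_on :: "'a set \<Rightarrow> ('a \<Rightarrow> 'a \<Rightarrow> real) \<Rightarrow> bool" where
  "quasi_pseudo_metric_on E p \<longleftrightarrow>
     (\<forall>x y. 0 \<le> p x y) \<and>
     (\<forall>x\<in>E. p x x = 0) \<and>
     (\<forall>x\<in>E. \<forall>y\<in>E. \<forall>z\<in>E. p x z \<le> p x y + p y z)"

definition Albert_quasi_metric_on :: "'a set \<Rightarrow> ('a \<Rightarrow> 'a \<Rightarrow> real) \<Rightarrow> bool" where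
  "Albert_quasi_metric_on E p \<longleftrightarrow>
     quasi_pseudo_metric_on E p \<and>
     (\<forall>x\<in>E. \<forall>y\<in>E. p x y = 0 \<and> p y x = 0 \<longleftrightarrow> x = y)"

definition conjugate :: "('a \<Rightarrow> 'a \<Rightarrow> real) \<Rightarrow> 'a \<Rightarrow> 'a \<Rightarrow> real" where
  "conjugate p x y = p y x"

definition join_dist ::
  "('a \<Rightarrow> 'a \<Rightarrow> real) \<Rightarrow> ('a \<Rightarrow> 'a \<Rightarrow> real) \<Rightarrow> 'a \<Rightarrow> 'a \<Rightarrow> real" where
  "join_dist p q x y = max (p x y) (q x y)"

text \<open>Hence \<open>Metric_space.mtopology E (join_dist p (conjugate p))\<close> is meaningful.\<close>

lemma Metric_space_join_dist_conjugate:
  assumes "Albert_quasi_metric_on E p"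
  shows "Metric_space E (join_dist p (conjugate p))"
proof
  have nn: "0 \<le> p x y" for x y
    using assms by (simp add: Albert_quasi_metric_on_def quasi_pseudo_metric_on_def)
  show "0 \<le> join_dist p (conjugate p) x y" for x y
    by (simp add: join_dist_def nn le_max_iff_disj)
  show "join_dist p (conjugate p) x y = join_dist p (conjugate p) y x" for x y
    by (simp add: join_dist_def conjugate_def max.commute)
  show "join_dist p (conjugate p) x y = 0 \<longleftrightarrow> x = y" if "x \<in> E" "y \<in> E" for x y
  proof -
    have "join_dist p (conjugate p) x y = 0 \<longleftrightarrow> p x y = 0 \<and> p y x = 0"
      using nn[of x y] nn[of y x] by (auto simp: join_dist_def conjugate_def)
    then show ?thesis
      using assms that by (simp add: Albert_quasi_metric_on_def)
  qed
  show "join_dist p (conjugate p) x z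
          \<le> join_dist p (conjugate p) x y + join_dist p (conjugate p) y z"
    if "x \<in> E" "y \<in> E" "z \<in> E" for x y z
  proof -
    have "p x z \<le> p x y + p y z" "p z x \<le> p z y + p y x"
      using assms that by (auto simp: Albert_quasi_metric_on_def quasi_pseudo_metric_on_def)
    then show ?thesis
      by (auto simp: join_dist_def conjugate_def)
  qed
qed

end

theory Submission
  imports Defs
begin

text \<open>
  Call a continuous isotone function with values in \<open>[0, 1]\<close> a utility. If \<open>F 0, F 1, \<dots>\<close> are utilities
  that determine the order (whenever \<open>x \<le> y\<close> fails, some \<open>F n\<close> is larger at \<open>x\<close> than at \<open>y\<close>) and the
  topology (the sets where one \<open>F m\<close> is below \<open>1\<close> and another \<open>F n\<close> is positive form a
  base), then the sum over \<open>n\<close> of \<open>2\<^sup>-\<^sup>n max (F n x - F n y) 0\<close> is the required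
  quasi-metric (\<open>quasi_metric_from_utilities\<close>). Second countability lets a countable family do the
  work of all utilities (\<open>countably_many_utilities\<close>), so the task is to produce enough utilities.

  Utilities come from an ordered Urysohn lemma (\<open>ordered_Urysohn\<close>), which requires that disjoint
  closed sets, one decreasing and one increasing, have disjoint open neighbourhoods of the same kinds.
  This normality is proved by filling the space with compact sets \<open>K n\<close>, each inside the interior of
  the next, and enlarging the two sets inside \<open>K 0, K 1, \<dots>\<close> in turn
  (\<open>separation_along_exhaustion\<close>): inside a compact set the enlargement is possible because the hulls
  of compact sets are closed, and passing from \<open>K n\<close> to the next compact set creates no new
  intersection because the order is transitive. Normality already gives utilities that determine the
  order.

  The topology is the point where the last hypothesis enters, since a neighbourhood of \<open>x\<close> must contain
  the intersection of a decreasing and an increasing neighbourhood of \<open>x\<close>.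

  \<^item> In the \<open>k\<close>-preserving case all \<open>K n\<close> can be taken convex. The enlargement is run on \<open>d {x}\<close> and
    \<open>i {x}\<close>, with the weaker aim that the two sets meet only inside the given neighbourhood. Any point
    where the hulls of the two sets meet lies, by convexity, in \<open>K n\<close> already, so again nothing new
    appears.
  \<^item> In the compactly generated case a continuous function is isotone as soon as it is monotone along
    the generating relation \<open>R\<close>, and one \<open>R\<close>-step from a compact neighbourhood \<open>C\<close> of \<open>x\<close> stays in a
    larger compact set. Finding utilities that detect \<open>x\<close> against the compact shell between the two is
    easy; then one of them can be changed outside that larger set without losing monotonicity along \<open>R\<close>, so that
    the detection holds everywhere (\<open>utility_neighbourhood_if_compactly_generated\<close>).
\<close>

section \<open>Closed preorders and monotone sets\<close>

definition decreasing_set :: "('a \<times> 'a) set \<Rightarrow> 'a set \<Rightarrow> bool" where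
  "decreasing_set G S \<longleftrightarrow> (\<forall>x y. (x, y) \<in> G \<longrightarrow> y \<in> S \<longrightarrow> x \<in> S)"

definition increasing_set :: "('a \<times> 'a) set \<Rightarrow> 'a set \<Rightarrow> bool" where
  "increasing_set G S \<longleftrightarrow> (\<forall>x y. (x, y) \<in> G \<longrightarrow> x \<in> S \<longrightarrow> y \<in> S)"

lemma increasing_hull_converse: "increasing_hull G = decreasing_hull (G\<inverse>)"
  by (auto simp: increasing_hull_def decreasing_hull_def fun_eq_iff)

lemma increasing_set_complement:
  assumes "decreasing_set G S" "G \<subseteq> E \<times> E"
  shows "increasing_set G (E - S)"
  using assms by (auto simp: increasing_set_def decreasing_set_def)

lemma decreasing_set_complement:
  assumes "increasing_set G S" "G \<subseteq> E \<times> E"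
  shows "decreasing_set G (E - S)"
  using assms by (auto simp: increasing_set_def decreasing_set_def)

lemma decreasing_hull_relative:
  "decreasing_set G D \<Longrightarrow> decreasing_hull G (D \<inter> K) \<inter> K \<subseteq> D \<inter> K"
  unfolding decreasing_set_def decreasing_hull_def by blast

lemma increasing_hull_relative:
  "increasing_set G D \<Longrightarrow> increasing_hull G (D \<inter> K) \<inter> K \<subseteq> D \<inter> K"
  unfolding increasing_set_def increasing_hull_def by blast

lemma closedin_prod_converse:
  assumes "closedin (prod_topology T T) G"
  shows "closedin (prod_topology T T) (G\<inverse>)"
proof -
  have G: "G \<subseteq> topspace T \<times> topspace T"
    using closedin_subset[OF assms] by simp
  have "continuous_map (prod_topology T T) (prod_topology T T) (\<lambda>z. (snd z, fst z))"
    by (simp add: continuous_map_pairedI continuous_map_fst continuous_map_snd)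
  then have "closedin (prod_topology T T)
      {z \<in> topspace (prod_topology T T). (snd z, fst z) \<in> G}"
    using assms by (rule closedin_continuous_map_preimage)
  also have "{z \<in> topspace (prod_topology T T). (snd z, fst z) \<in> G} = G\<inverse>"
    using G by auto
  finally show ?thesis .
qed

lemma closed_preorder_converse:
  assumes "closed_preorder T G"
  shows "closed_preorder T (G\<inverse>)"
  using assms closedin_prod_converse by (auto simp: closed_preorder_def)

text \<open>
  By antisymmetry the diagonal is the intersection of the graph with its converse, hence closed.
\<close>
lemma T2_ordered_imp_Hausdorff:
  assumes "T2_ordered T G"
  shows "Hausdorff_space T"
proof -
  have G: "partial_order_on (topspace T) G" "closedin (prod_topology T T) G"
    using assms by (auto simp: T2_ordered_def)
  have "closedin (prod_topology T T) (G \<inter> G\<inverse>)"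
    using G closedin_prod_converse by blast
  moreover have "G \<inter> G\<inverse> = (\<lambda>x. (x, x)) ` topspace T"
    using G(1) by (auto simp: partial_order_on_def preorder_on_def refl_on_def antisym_def)
  ultimately show ?thesis
    by (simp add: Hausdorff_space_closedin_diagonal)
qed

text \<open>
  The Hausdorff property is assumed separately because a preorder with closed graph need not force it;
  it is what makes compact sets closed and separable by open sets.
\<close>
locale closed_preordered_Hausdorff_space =
  fixes T :: "'a topology" and G :: "('a \<times> 'a) set"
  assumes closed_preorder: "closed_preorder T G"
    and Hausdorff: "Hausdorff_space T"
begin

lemma graph_subset: "G \<subseteq> topspace T \<times> topspace T"
  and graph_closed: "closedin (prod_topology T T) G"
  and graph_refl: "x \<in> topspace T \<Longrightarrow> (x, x) \<in> G"
  and graph_trans: "(x, y) \<in> G \<Longrightarrow> (y, z) \<in> G \<Longrightarrow> (x, z) \<in> G"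
  using closed_preorder unfolding closed_preorder_def preorder_on_def refl_on_def trans_def
  by blast+

text \<open>
  Order duality: it halves the work below, since facts on increasing hulls are facts on decreasing
  hulls for the converse order.
\<close>
lemma converse_space: "closed_preordered_Hausdorff_space T (G\<inverse>)"
  using Hausdorff closed_preorder_converse[OF closed_preorder] by unfold_locales

lemma decreasing_set_hull: "decreasing_set G (decreasing_hull G S)"
  using graph_trans unfolding decreasing_set_def decreasing_hull_def by blast

lemma increasing_set_hull: "increasing_set G (increasing_hull G S)"
  using graph_trans unfolding increasing_set_def increasing_hull_def by blast

lemma subset_decreasing_hull: "S \<subseteq> topspace T \<Longrightarrow> S \<subseteq> decreasing_hull G S"
  using graph_refl unfolding decreasing_hull_def by blast

lemma subset_increasing_hull: "S \<subseteq> topspace T \<Longrightarrow> S \<subseteq> increasing_hull G S"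
  using graph_refl unfolding increasing_hull_def by blast

text \<open>
  The hull is the projection along the compact factor \<open>A\<close> of the part of the graph over \<open>A\<close>, and
  projections along compact factors are closed maps.
\<close>
lemma closedin_decreasing_hull_compact:
  assumes "compactin T A"
  shows "closedin T (decreasing_hull G A)"
proof -
  have A: "A \<subseteq> topspace T"
    using assms by (rule compactin_subset_topspace)
  have "closed_map (prod_topology T (subtopology T A)) T fst"
    using assms by (intro closed_map_fst compact_space_subtopology)
  moreover have "closedin (prod_topology T (subtopology T A)) (G \<inter> (topspace T \<times> A))"
    using closedin_subtopology_Int_closed[OF graph_closed, of "topspace T \<times> A"]
    by (simp add: prod_topology_subtopology Int_commute)
  ultimately have "closedin T (fst ` (G \<inter> (topspace T \<times> A)))"
    by (simp add: closed_map_def)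
  moreover have "fst ` (G \<inter> (topspace T \<times> A)) = decreasing_hull G A"
    using graph_subset by (force simp: decreasing_hull_def)
  ultimately show ?thesis
    by simp
qed

lemma closedin_increasing_hull_compact:
  assumes "compactin T A"
  shows "closedin T (increasing_hull G A)"
  unfolding increasing_hull_converse
  by (rule closed_preordered_Hausdorff_space.closedin_decreasing_hull_compact
      [OF converse_space assms])

section \<open>Separation along a compact exhaustion\<close>

text \<open>
  The points of \<open>K\<close> above some point of \<open>Y\<close> form a compact set \<open>M\<close> disjoint from \<open>A\<close>. Separate \<open>M\<close> from
  \<open>A\<close> by open sets; the decreasing hull of what remains of \<open>K\<close> off the neighbourhood of \<open>M\<close> contains a
  neighbourhood of \<open>A\<close> and cannot reach \<open>Y\<close>.
\<close>
lemma relative_decreasing_neighbourhood: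
  assumes K: "compactin T K" and A: "compactin T A" "A \<subseteq> K" "decreasing_hull G A \<inter> K \<subseteq> A"
    and Y: "compactin T Y" "Y \<subseteq> K" "A \<inter> Y = {}"
  obtains N B where "openin T N" "A \<subseteq> N" "N \<inter> K \<subseteq> B" "compactin T B" "B \<subseteq> K"
    "decreasing_hull G B \<inter> K \<subseteq> B" "B \<inter> Y = {}"
proof -
  define M where "M = increasing_hull G Y \<inter> K"
  have M: "compactin T M"
    unfolding M_def using closedin_increasing_hull_compact[OF Y(1)] K by (rule closed_Int_compactin)
  have AM: "disjnt A M"
  proof (unfold disjnt_iff, intro allI notI)
    fix a assume a: "a \<in> A \<and> a \<in> M"
    then obtain y where "y \<in> Y" "(y, a) \<in> G"
      by (auto simp: M_def increasing_hull_def)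
    then have "y \<in> decreasing_hull G A \<inter> K"
      using a Y(2) by (auto simp: decreasing_hull_def)
    then show False
      using A(3) Y(3) \<open>y \<in> Y\<close> by blast
  qed
  obtain N N' where N: "openin T N" "openin T N'" "A \<subseteq> N" "M \<subseteq> N'" "disjnt N N'"
    using Hausdorff_space_compact_separation[OF Hausdorff A(1) M AM] .
  define L where "L = (topspace T - N') \<inter> K"
  have L: "compactin T L"
    unfolding L_def using N(2) K by (intro closed_Int_compactin) auto
  define B where "B = decreasing_hull G L \<inter> K"
  show thesis
  proof
    show "compactin T B"
      unfolding B_def using closedin_decreasing_hull_compact[OF L] K by (rule closed_Int_compactin)
    have "L \<subseteq> decreasing_hull G L"
      using L by (intro subset_decreasing_hull compactin_subset_topspace)
    then show "N \<inter> K \<subseteq> B"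
      using N(5) openin_subset[OF N(1)] unfolding B_def L_def disjnt_def by blast
    show "decreasing_hull G B \<inter> K \<subseteq> B"
      unfolding B_def using decreasing_set_hull by (rule decreasing_hull_relative)
    have False if "y \<in> Y" "k \<in> L" "(y, k) \<in> G" for y k
    proof -
      have "k \<in> M"
        using that by (auto simp: M_def L_def increasing_hull_def)
      then show False
        using N(4) that(2) by (auto simp: L_def)
    qed
    then show "B \<inter> Y = {}"
      by (auto simp: B_def decreasing_hull_def)
    show "openin T N" "A \<subseteq> N" "B \<subseteq> K"
      using N B_def by simp_all
  qed
qed

text \<open>
  This is the enlargement step inside a compact set \<open>K\<close>. Only the points of \<open>Z\<close> matter: inside
  \<open>Z \<inter> K\<close> the traces of \<open>A\<close> and \<open>B\<close> are disjoint compact sets, so each can be given a neighbourhood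
  avoiding the points of \<open>Z \<inter> K\<close> that are not close to it.
\<close>
lemma relative_separating_neighbourhoods:
  assumes K: "compactin T K"
    and A: "compactin T A" "A \<subseteq> K" "decreasing_hull G A \<inter> K \<subseteq> A"
    and B: "compactin T B" "B \<subseteq> K" "increasing_hull G B \<inter> K \<subseteq> B"
    and Z: "closedin T Z" "A \<inter> B \<inter> Z = {}"
  obtains N A' M B' where
    "openin T N" "A \<subseteq> N" "N \<inter> K \<subseteq> A'" "compactin T A'" "A' \<subseteq> K" "decreasing_hull G A' \<inter> K \<subseteq> A'"
    "openin T M" "B \<subseteq> M" "M \<inter> K \<subseteq> B'" "compactin T B'" "B' \<subseteq> K" "increasing_hull G B' \<inter> K \<subseteq> B'"
    "A' \<inter> B' \<inter> Z = {}"
proof -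
  interpret op: closed_preordered_Hausdorff_space T "G\<inverse>"
    by (rule converse_space)
  have "compactin T (Z \<inter> A)" "compactin T (Z \<inter> B)"
    using Z A B by (auto intro: closed_Int_compactin)
  moreover have "disjnt (Z \<inter> A) (Z \<inter> B)"
    using Z(2) by (auto simp: disjnt_def)
  ultimately obtain P Q where PQ: "openin T P" "openin T Q" "Z \<inter> A \<subseteq> P" "Z \<inter> B \<subseteq> Q" "disjnt P Q"
    using Hausdorff unfolding Hausdorff_space_compact_sets by meson
  have cpt: "compactin T (Z \<inter> K)"
    using Z K by (intro closed_Int_compactin)
  have *: "compactin T ((topspace T - U) \<inter> (Z \<inter> K))" if "openin T U" for U
    using closed_Int_compactin[OF _ cpt, of "topspace T - U"] that by auto
  have "(topspace T - P) \<inter> (Z \<inter> K) \<subseteq> K" "A \<inter> ((topspace T - P) \<inter> (Z \<inter> K)) = {}"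
    using PQ(3) by blast+
  then obtain N A' where N: "openin T N" "A \<subseteq> N" "N \<inter> K \<subseteq> A'" "compactin T A'" "A' \<subseteq> K"
    "decreasing_hull G A' \<inter> K \<subseteq> A'" "A' \<inter> ((topspace T - P) \<inter> (Z \<inter> K)) = {}"
    by (rule relative_decreasing_neighbourhood[OF K A *[OF PQ(1)]])
  have "(topspace T - Q) \<inter> (Z \<inter> K) \<subseteq> K" "B \<inter> ((topspace T - Q) \<inter> (Z \<inter> K)) = {}"
    using PQ(4) by blast+
  then obtain M B' where M: "openin T M" "B \<subseteq> M" "M \<inter> K \<subseteq> B'" "compactin T B'" "B' \<subseteq> K"
    "increasing_hull G B' \<inter> K \<subseteq> B'" "B' \<inter> ((topspace T - Q) \<inter> (Z \<inter> K)) = {}"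
    unfolding increasing_hull_converse
    by (rule op.relative_decreasing_neighbourhood
        [OF K B[unfolded increasing_hull_converse] *[OF PQ(2)]])
  have "A' \<inter> B' \<inter> Z = {}"
    using N(5,7) M(5,7) PQ(5) compactin_subset_topspace[OF K] unfolding disjnt_def by blast
  with N(1-6) M(1-6) show thesis
    by (rule that)
qed

text \<open>
  The set \<open>Z\<close> consists of the points where the two neighbourhoods must not meet. The premise \<open>carry\<close>
  says that taking hulls in the whole space, and adding the rest of \<open>F\<close> and \<open>H\<close>, of a pair that is
  already good inside \<open>K n\<close> creates no intersection within \<open>Z\<close>. It is kept as a premise because it has two
  different reasons: transitivity and monotonicity when \<open>Z\<close> is the whole space, convexity of \<open>K n\<close> when \<open>F\<close> and
  \<open>H\<close> are the hulls of a point.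

  The neighbourhoods are increasing unions of compact sets, monotone relative to \<open>K n\<close>. The unions are
  open because each set is a neighbourhood, relative to the next compact set, of its predecessor,
  and monotone because every point lies in some \<open>K n\<close>.
\<close>
proposition separation_along_exhaustion:
  assumes K: "\<And>n. compactin T (K n)" "\<And>n. K n \<subseteq> T interior_of K (Suc n)" "(\<Union>n. K n) = topspace T"
    and F: "closedin T F" "decreasing_set G F"
    and H: "closedin T H" "increasing_set G H"
    and Z: "closedin T Z" "F \<inter> H \<inter> Z = {}"
    and carry: "\<And>n A B. \<lbrakk>A \<subseteq> K n; B \<subseteq> K n; F \<inter> K n \<subseteq> A; H \<inter> K n \<subseteq> B;
        decreasing_hull G A \<inter> K n \<subseteq> A; increasing_hull G B \<inter> K n \<subseteq> B; A \<inter> B \<inter> Z = {}\<rbrakk>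
      \<Longrightarrow> (decreasing_hull G A \<union> F) \<inter> (increasing_hull G B \<union> H) \<inter> Z = {}"
  obtains U V where "openin T U" "decreasing_set G U" "F \<subseteq> U"
    "openin T V" "increasing_set G V" "H \<subseteq> V" "U \<inter> V \<inter> Z = {}"
proof -
  define inv where "inv n C \<longleftrightarrow>
      compactin T (fst C) \<and> fst C \<subseteq> K n \<and> decreasing_hull G (fst C) \<inter> K n \<subseteq> fst C \<and> F \<inter> K n \<subseteq> fst C \<and>
      compactin T (snd C) \<and> snd C \<subseteq> K n \<and> increasing_hull G (snd C) \<inter> K n \<subseteq> snd C \<and> H \<inter> K n \<subseteq> snd C \<and>
      fst C \<inter> snd C \<inter> Z = {}" for n and C :: "'a set \<times> 'a set"
  define step where "step n C D \<longleftrightarrow>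
      (\<exists>N. openin T N \<and> fst C \<subseteq> N \<and> N \<inter> K (Suc n) \<subseteq> fst D) \<and>
      (\<exists>N. openin T N \<and> snd C \<subseteq> N \<and> N \<inter> K (Suc n) \<subseteq> snd D)" for n and C D :: "'a set \<times> 'a set"
  have KS: "K n \<subseteq> K (Suc n)" for n
    using K(2) interior_of_subset by (rule subset_trans)
  have inv_0: "inv 0 (F \<inter> K 0, H \<inter> K 0)"
    unfolding inv_def fst_conv snd_conv
  proof (intro conjI)
    show "compactin T (F \<inter> K 0)" "compactin T (H \<inter> K 0)"
      using F(1) H(1) K(1) by (simp_all add: closed_Int_compactin)
    show "decreasing_hull G (F \<inter> K 0) \<inter> K 0 \<subseteq> F \<inter> K 0"
      using F(2) by (rule decreasing_hull_relative)
    show "increasing_hull G (H \<inter> K 0) \<inter> K 0 \<subseteq> H \<inter> K 0"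
      using H(2) by (rule increasing_hull_relative)
    show "F \<inter> K 0 \<inter> (H \<inter> K 0) \<inter> Z = {}"
      using Z(2) by blast
  qed simp_all
  have inv_Suc: "\<exists>D. inv (Suc n) D \<and> step n C D" if C: "inv n C" for n C
  proof -
    define A where "A = (decreasing_hull G (fst C) \<union> F) \<inter> K (Suc n)"
    define B where "B = (increasing_hull G (snd C) \<union> H) \<inter> K (Suc n)"
    \<comment> \<open>The pair inside \<open>K n\<close>, spread to \<open>K (Suc n)\<close> by monotonicity, before it is enlarged.\<close>
    have A: "compactin T A" "A \<subseteq> K (Suc n)"
      using C F(1) K(1)
      by (auto simp: inv_def A_def intro!: closed_Int_compactin closedin_Un closedin_decreasing_hull_compact)
    have A': "decreasing_hull G A \<inter> K (Suc n) \<subseteq> A"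
      unfolding A_def using F(2) decreasing_set_hull[of "fst C"]
      by (intro decreasing_hull_relative) (auto simp: decreasing_set_def)
    have B: "compactin T B" "B \<subseteq> K (Suc n)"
      using C H(1) K(1)
      by (auto simp: inv_def B_def intro!: closed_Int_compactin closedin_Un closedin_increasing_hull_compact)
    have B': "increasing_hull G B \<inter> K (Suc n) \<subseteq> B"
      unfolding B_def using H(2) increasing_set_hull[of "snd C"]
      by (intro increasing_hull_relative) (auto simp: increasing_set_def)
    have sub: "fst C \<subseteq> A"
    proof -
      have "fst C \<subseteq> decreasing_hull G (fst C)"
        using C by (intro subset_decreasing_hull compactin_subset_topspace) (simp add: inv_def)
      then show ?thesis
        using C KS[of n] unfolding A_def inv_def by blast
    qed
    have sub': "snd C \<subseteq> B"
    proof -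
      have "snd C \<subseteq> increasing_hull G (snd C)"
        using C by (intro subset_increasing_hull compactin_subset_topspace) (simp add: inv_def)
      then show ?thesis
        using C KS[of n] unfolding B_def inv_def by blast
    qed
    have "(decreasing_hull G (fst C) \<union> F) \<inter> (increasing_hull G (snd C) \<union> H) \<inter> Z = {}"
      using C by (intro carry[of "fst C" n "snd C"]) (simp_all only: inv_def)
    then have "A \<inter> B \<inter> Z = {}"
      unfolding A_def B_def by blast
    then obtain N A' M B' where
      N: "openin T N" "A \<subseteq> N" "N \<inter> K (Suc n) \<subseteq> A'" "compactin T A'" "A' \<subseteq> K (Suc n)"
        "decreasing_hull G A' \<inter> K (Suc n) \<subseteq> A'" and
      M: "openin T M" "B \<subseteq> M" "M \<inter> K (Suc n) \<subseteq> B'" "compactin T B'" "B' \<subseteq> K (Suc n)"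
        "increasing_hull G B' \<inter> K (Suc n) \<subseteq> B'" and
      disj: "A' \<inter> B' \<inter> Z = {}"
      by (rule relative_separating_neighbourhoods[OF K(1) A A' B B' Z(1)])
    have "F \<inter> K (Suc n) \<subseteq> A" "H \<inter> K (Suc n) \<subseteq> B"
      by (auto simp: A_def B_def)
    then have "inv (Suc n) (A', B')"
      using N M disj unfolding inv_def fst_conv snd_conv by blast
    moreover have "step n C (A', B')"
      unfolding step_def fst_conv snd_conv
      using N(1,3) M(1,3) subset_trans[OF sub N(2)] subset_trans[OF sub' M(2)] by metis
    ultimately show ?thesis
      by blast
  qed
  have "\<exists>C. \<forall>n. inv n (C n) \<and> step n (C n) (C (Suc n))"
    using inv_0 inv_Suc by (rule dependent_nat_choice[OF exI])
  then obtain C where CC: "\<forall>n. inv n (C n) \<and> step n (C n) (C (Suc n))"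
    by (rule exE)
  have C: "inv n (C n)" "step n (C n) (C (Suc n))" for n
    using CC by simp_all
  have nbhd: "\<exists>N. openin T N \<and> X \<subseteq> N \<and> N \<subseteq> Y"
    if X: "X \<subseteq> K n" and "\<exists>N. openin T N \<and> X \<subseteq> N \<and> N \<inter> K (Suc n) \<subseteq> Y" for X Y n
  proof -
    from that(2) obtain N where N: "openin T N \<and> X \<subseteq> N \<and> N \<inter> K (Suc n) \<subseteq> Y"
      by (rule exE)
    have "openin T (N \<inter> T interior_of K (Suc n))"
      using N by (intro openin_Int) simp_all
    moreover have "X \<subseteq> N \<inter> T interior_of K (Suc n)"
      using N subset_trans[OF X K(2)] by simp
    moreover have "N \<inter> T interior_of K (Suc n) \<subseteq> Y"
      using N interior_of_subset[of T "K (Suc n)"] by blast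
    ultimately show ?thesis
      by (intro exI conjI)
  qed
  have nA: "\<exists>N. openin T N \<and> fst (C n) \<subseteq> N \<and> N \<subseteq> fst (C (Suc n))" for n
    using C[of n] unfolding inv_def step_def by (intro nbhd[of _ n]) simp_all
  have nB: "\<exists>N. openin T N \<and> snd (C n) \<subseteq> N \<and> N \<subseteq> snd (C (Suc n))" for n
    using C[of n] unfolding inv_def step_def by (intro nbhd[of _ n]) simp_all
  have incA: "fst (C m) \<subseteq> fst (C n)" if "m \<le> n" for m n
    using nA by (intro lift_Suc_mono_le[OF _ that, of "\<lambda>n. fst (C n)"]) (meson subset_trans)
  have incB: "snd (C m) \<subseteq> snd (C n)" if "m \<le> n" for m n
    using nB by (intro lift_Suc_mono_le[OF _ that, of "\<lambda>n. snd (C n)"]) (meson subset_trans)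
  have incK: "K m \<subseteq> K n" if "m \<le> n" for m n
    using KS that by (rule lift_Suc_mono_le)
  have opn: "openin T (\<Union>n. X n)"
    if X: "\<And>n. \<exists>N. openin T N \<and> X n \<subseteq> N \<and> N \<subseteq> X (Suc n)" for X :: "nat \<Rightarrow> 'a set"
  proof (subst openin_subopen, intro ballI)
    fix x assume "x \<in> (\<Union>n. X n)"
    then obtain n where "x \<in> X n"
      by blast
    with X[of n] show "\<exists>N. openin T N \<and> x \<in> N \<and> N \<subseteq> (\<Union>n. X n)"
      by blast
  qed
  show thesis
  proof
    show "openin T (\<Union>n. fst (C n))"
      using nA by (rule opn)
    show "openin T (\<Union>n. snd (C n))"
      using nB by (rule opn)
    show "decreasing_set G (\<Union>n. fst (C n))"
      unfolding decreasing_set_def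
    proof (intro allI impI)
      fix x y assume xy: "(x, y) \<in> G" "y \<in> (\<Union>n. fst (C n))"
      then obtain n where n: "y \<in> fst (C n)"
        by blast
      have "x \<in> topspace T"
        using xy graph_subset by auto
      then obtain m where m: "x \<in> K m"
        using K(3) by blast
      have "x \<in> decreasing_hull G (fst (C (max m n))) \<inter> K (max m n)"
        using xy(1) n m incA[of n "max m n"] incK[of m "max m n"] by (auto simp: decreasing_hull_def)
      then show "x \<in> (\<Union>n. fst (C n))"
        using C(1)[of "max m n"] by (auto simp: inv_def)
    qed
    show "increasing_set G (\<Union>n. snd (C n))"
      unfolding increasing_set_def
    proof (intro allI impI)
      fix x y assume xy: "(x, y) \<in> G" "x \<in> (\<Union>n. snd (C n))"
      then obtain n where n: "x \<in> snd (C n)"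
        by blast
      have "y \<in> topspace T"
        using xy graph_subset by auto
      then obtain m where m: "y \<in> K m"
        using K(3) by blast
      have "y \<in> increasing_hull G (snd (C (max m n))) \<inter> K (max m n)"
        using xy(1) n m incB[of n "max m n"] incK[of m "max m n"] by (auto simp: increasing_hull_def)
      then show "y \<in> (\<Union>n. snd (C n))"
        using C(1)[of "max m n"] by (auto simp: inv_def)
    qed
    have covered: "X \<subseteq> (\<Union>n. Y n)"
      if "closedin T X" "\<And>n. X \<inter> K n \<subseteq> Y n" for X and Y :: "nat \<Rightarrow> 'a set"
    proof
      fix x assume x: "x \<in> X"
      then have "x \<in> (\<Union>n. K n)"
        using closedin_subset[OF that(1)] K(3) by auto
      then show "x \<in> (\<Union>n. Y n)"
        using x that(2) by blast
    qed
    show "F \<subseteq> (\<Union>n. fst (C n))"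
      using C(1) unfolding inv_def by (intro covered[OF F(1)]) simp
    show "H \<subseteq> (\<Union>n. snd (C n))"
      using C(1) unfolding inv_def by (intro covered[OF H(1)]) simp
    show "(\<Union>n. fst (C n)) \<inter> (\<Union>n. snd (C n)) \<inter> Z = {}"
    proof -
      have False if "z \<in> fst (C m)" "z \<in> snd (C n)" "z \<in> Z" for z m n
      proof -
        have "z \<in> fst (C (max m n))" "z \<in> snd (C (max m n))"
          using that incA[of m "max m n"] incB[of n "max m n"] by auto
        then show False
          using \<open>z \<in> Z\<close> C(1)[of "max m n"] unfolding inv_def by blast
      qed
      then show ?thesis
        by blast
    qed
  qed
qed

end

section \<open>Compact exhaustions\<close>

text \<open>
  The property \<open>Q\<close> lets every stage be replaced by a larger compact set of a prescribed kind, as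
  needed for convex exhaustions, and \<open>L\<close> lets the first stage contain a given point.
\<close>
lemma compact_exhaustion:
  assumes T: "Hausdorff_space T" "locally_compact_space T" "second_countable T"
    and L: "compactin T L"
    and Q: "\<And>C. compactin T C \<Longrightarrow> \<exists>C'. compactin T C' \<and> C \<subseteq> C' \<and> Q C'"
  obtains K where "\<And>n::nat. compactin T (K n)" "\<And>n. K n \<subseteq> T interior_of K (Suc n)"
    "(\<Union>n. K n) = topspace T" "L \<subseteq> K 0" "\<And>n. Q (K n)"
proof -
  define \<U> where "\<U> = {U. openin T U \<and> (\<exists>C. compactin T C \<and> U \<subseteq> C)}"
  have "\<Union>\<U> = topspace T"
    using T(2) openin_subset by (fastforce simp: \<U>_def locally_compact_space_def)
  then obtain \<V> where \<V>: "countable \<V>" "\<V> \<subseteq> \<U>" "\<Union>\<V> = topspace T"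
    using Lindelof_spaceD[OF second_countable_imp_Lindelof_space[OF T(3)], of \<U>]
    by (auto simp: \<U>_def)
  \<comment> \<open>The empty set is added so that the enumeration also works when the space is empty.\<close>
  define v where "v = from_nat_into (insert {} \<V>)"
  have "range v = insert {} \<V>"
    unfolding v_def using \<V>(1) by (intro range_from_nat_into) auto
  then have v: "(\<Union>n. v n) = topspace T"
    using \<V>(3) by simp
  have v': "\<exists>C. compactin T C \<and> v n \<subseteq> C" for n
  proof -
    have "v n \<in> insert {} \<V>"
      using \<open>range v = _\<close> by blast
    then show ?thesis
      using \<V>(2) by (auto simp: \<U>_def intro: exI[of _ "{}"])
  qed
  have "\<exists>K. \<forall>n. (compactin T (K n) \<and> Q (K n) \<and> (n = 0 \<longrightarrow> L \<subseteq> K n)) \<and>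
      (K n \<union> v n \<subseteq> K (Suc n) \<and> K n \<subseteq> T interior_of K (Suc n))"
  proof (rule dependent_nat_choice)
    show "\<exists>x. compactin T x \<and> Q x \<and> (0 = (0::nat) \<longrightarrow> L \<subseteq> x)"
      using Q[OF L] by auto
    fix C n
    assume C: "compactin T C \<and> Q C \<and> (n = (0::nat) \<longrightarrow> L \<subseteq> C)"
    obtain U D where U: "openin T U" "compactin T D" "C \<subseteq> U" "U \<subseteq> D"
      using locally_compact_space_compact_closed_compact[of T] T(1,2) C by blast
    obtain D' where D': "compactin T D'" "v n \<subseteq> D'"
      using v' by blast
    obtain C' where C': "compactin T C'" "D \<union> D' \<subseteq> C'" "Q C'"
      using Q[of "D \<union> D'"] U D' compactin_Un by blast
    have "C \<subseteq> T interior_of C'"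
      using U C' interior_of_maximal[of U C' T] by blast
    with U D' C' show "\<exists>y. (compactin T y \<and> Q y \<and> (Suc n = 0 \<longrightarrow> L \<subseteq> y)) \<and>
         C \<union> v n \<subseteq> y \<and> C \<subseteq> T interior_of y"
      by blast
  qed
  then obtain K where *: "\<forall>n. (compactin T (K n) \<and> Q (K n) \<and> (n = 0 \<longrightarrow> L \<subseteq> K n)) \<and>
      (K n \<union> v n \<subseteq> K (Suc n) \<and> K n \<subseteq> T interior_of K (Suc n))"
    by (rule exE)
  then have K: "\<And>n. compactin T (K n)" "\<And>n. Q (K n)" "L \<subseteq> K 0"
    "\<And>n. v n \<subseteq> K (Suc n)" "\<And>n. K n \<subseteq> T interior_of K (Suc n)"
    by simp_all
  have "topspace T \<subseteq> (\<Union>n. K n)"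
    unfolding v[symmetric] using K(4) by blast
  moreover have "(\<Union>n. K n) \<subseteq> topspace T"
    using compactin_subset_topspace[OF K(1)] by blast
  ultimately show thesis
    using K by (intro that[of K]) simp_all
qed


section \<open>Normality and convexity\<close>

definition normally_preordered :: "'a topology \<Rightarrow> ('a \<times> 'a) set \<Rightarrow> bool" where
  "normally_preordered T G \<longleftrightarrow>
     (\<forall>F H. closedin T F \<and> decreasing_set G F \<and> closedin T H \<and> increasing_set G H \<and> F \<inter> H = {} \<longrightarrow>
        (\<exists>U V. openin T U \<and> decreasing_set G U \<and> F \<subseteq> U \<and>
               openin T V \<and> increasing_set G V \<and> H \<subseteq> V \<and> U \<inter> V = {}))"

context closed_preordered_Hausdorff_space
begin

text \<open>
  The common points of the hulls are excluded by transitivity: if \<open>b \<le> z \<le> a\<close> with \<open>b \<in> B\<close> and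
  \<open>a \<in> A\<close>, then \<open>b \<le> a\<close>, and as \<open>b\<close> lies in \<open>K n\<close> it belongs to the relatively decreasing set \<open>A\<close>.
\<close>
theorem normally_preordered_if_locally_compact:
  assumes "locally_compact_space T" "second_countable T"
  shows "normally_preordered T G"
  unfolding normally_preordered_def
proof (intro allI impI, elim conjE)
  fix F H
  assume F: "closedin T F" "decreasing_set G F" and H: "closedin T H" "increasing_set G H"
    and FH: "F \<inter> H = {}"
  obtain K where K: "\<And>n::nat. compactin T (K n)" "\<And>n. K n \<subseteq> T interior_of K (Suc n)"
    "(\<Union>n. K n) = topspace T" "{} \<subseteq> K 0" "\<And>n. True"
    by (rule compact_exhaustion[OF Hausdorff assms compactin_empty, where Q = "\<lambda>_. True"]) auto
  have KE: "K n \<subseteq> topspace T" for n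
    using K(1) by (rule compactin_subset_topspace)
  have carry: "(decreasing_hull G A \<union> F) \<inter> (increasing_hull G B \<union> H) \<inter> topspace T = {}"
    if AB: "A \<subseteq> K n" "B \<subseteq> K n" "F \<inter> K n \<subseteq> A" "H \<inter> K n \<subseteq> B"
      "decreasing_hull G A \<inter> K n \<subseteq> A" "A \<inter> B \<inter> topspace T = {}" for n A B
  proof -
    have disj: "A \<inter> B = {}"
      using AB KE[of n] by blast
    have False if zA: "z \<in> decreasing_hull G A" and zB: "z \<in> increasing_hull G B" for z
    proof -
      obtain a where "a \<in> A" "(z, a) \<in> G"
        using zA by (auto simp: decreasing_hull_def)
      moreover obtain b where "b \<in> B" "(b, z) \<in> G"
        using zB by (auto simp: increasing_hull_def)
      moreover note ab = calculation
      ultimately have "b \<in> decreasing_hull G A"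
        using graph_trans[of b z a] by (auto simp: decreasing_hull_def)
      then show False
        using ab AB disj by blast
    qed
    moreover have False if zA: "z \<in> decreasing_hull G A" and zH: "z \<in> H" for z
    proof -
      obtain a where a: "a \<in> A" "(z, a) \<in> G"
        using zA by (auto simp: decreasing_hull_def)
      then have "a \<in> H"
        using H(2) zH by (auto simp: increasing_set_def)
      then show False
        using a AB disj by blast
    qed
    moreover have False if zF: "z \<in> F" and zB: "z \<in> increasing_hull G B" for z
    proof -
      obtain b where b: "b \<in> B" "(b, z) \<in> G"
        using zB by (auto simp: increasing_hull_def)
      then have "b \<in> F"
        using F(2) zF by (auto simp: decreasing_set_def)
      then show False
        using b AB disj by blast
    qed
    ultimately show ?thesis
      using FH by blast
  qed
  have "F \<inter> H \<inter> topspace T = {}"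
    using FH by blast
  then obtain U V where UV: "openin T U" "decreasing_set G U" "F \<subseteq> U"
    "openin T V" "increasing_set G V" "H \<subseteq> V" "U \<inter> V \<inter> topspace T = {}"
    using carry by (rule separation_along_exhaustion[OF K(1-3) F H closedin_topspace])
  moreover have "U \<inter> V = {}"
    using UV(7) openin_subset[OF UV(1)] by blast
  ultimately show "\<exists>U V. openin T U \<and> decreasing_set G U \<and> F \<subseteq> U \<and>
               openin T V \<and> increasing_set G V \<and> H \<subseteq> V \<and> U \<inter> V = {}"
    by (intro exI conjI)
qed

text \<open>
  Replacing a compact \<open>C\<close> by \<open>d C \<inter> i C\<close>, which is compact by \<open>k\<close>-preservation, makes every stage of
  the exhaustion convex. Then no point outside \<open>K n\<close> lies between two points of \<open>K n\<close>, so spreading a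
  pair of sets beyond \<open>K n\<close> adds nothing to their intersection.
\<close>
theorem convex_neighbourhoods_if_k_preserving:
  assumes "antisym G" "locally_compact_space T" "second_countable T" "k_preserving T G"
    and O: "openin T O'" "x \<in> O'"
  obtains U V where "openin T U" "decreasing_set G U" "x \<in> U"
    "openin T V" "increasing_set G V" "x \<in> V" "U \<inter> V \<subseteq> O'"
proof -
  have x: "x \<in> topspace T"
    using O openin_subset by blast
  have hull: "\<exists>C'. compactin T C' \<and> C \<subseteq> C' \<and> decreasing_hull G C' \<inter> increasing_hull G C' \<subseteq> C'"
    if C: "compactin T C" for C
  proof (intro exI conjI)
    let ?C' = "decreasing_hull G C \<inter> increasing_hull G C"
    show "compactin T ?C'"
      using assms(4) C by (simp add: k_preserving_def)
    show "C \<subseteq> ?C'"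
      using subset_decreasing_hull[of C] subset_increasing_hull[of C] compactin_subset_topspace[OF C]
      by simp
    have "decreasing_hull G ?C' \<subseteq> decreasing_hull G C"
      using graph_trans unfolding decreasing_hull_def by blast
    moreover have "increasing_hull G ?C' \<subseteq> increasing_hull G C"
      using graph_trans unfolding increasing_hull_def by blast
    ultimately show "decreasing_hull G ?C' \<inter> increasing_hull G ?C' \<subseteq> ?C'"
      by blast
  qed
  have x1: "compactin T {x}"
    using x by simp
  obtain K where K: "\<And>n::nat. compactin T (K n)" "\<And>n. K n \<subseteq> T interior_of K (Suc n)"
    "(\<Union>n. K n) = topspace T" "{x} \<subseteq> K 0"
    and convex: "\<And>n. decreasing_hull G (K n) \<inter> increasing_hull G (K n) \<subseteq> K n"
    by (rule compact_exhaustion[where Q = "\<lambda>C. decreasing_hull G C \<inter> increasing_hull G C \<subseteq> C",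
          OF Hausdorff assms(2,3) x1 hull]) (assumption, rule that, simp_all)
  have xK: "x \<in> K n" for n
  proof -
    have "K 0 \<subseteq> K n"
      using subset_trans[OF K(2) interior_of_subset] by (rule lift_Suc_mono_le) simp
    then show ?thesis
      using K(4) by blast
  qed
  let ?F = "decreasing_hull G {x}" and ?H = "increasing_hull G {x}"
  have xF: "x \<in> ?F" and xH: "x \<in> ?H"
    using graph_refl[OF x] by (auto simp: decreasing_hull_def increasing_hull_def)
  have carry: "(decreasing_hull G A \<union> ?F) \<inter> (increasing_hull G B \<union> ?H) \<inter> (topspace T - O') = {}"
    if AB: "A \<subseteq> K n" "B \<subseteq> K n" "?F \<inter> K n \<subseteq> A" "?H \<inter> K n \<subseteq> B"
      "decreasing_hull G A \<inter> K n \<subseteq> A" "increasing_hull G B \<inter> K n \<subseteq> B"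
      "A \<inter> B \<inter> (topspace T - O') = {}" for n A B
  proof -
    have "x \<in> A" "x \<in> B"
      using AB(3,4) xF xH xK[of n] by blast+
    then have "?F \<subseteq> decreasing_hull G A" "?H \<subseteq> increasing_hull G B"
      by (auto simp: decreasing_hull_def increasing_hull_def)
    moreover have "decreasing_hull G A \<subseteq> decreasing_hull G (K n)"
      "increasing_hull G B \<subseteq> increasing_hull G (K n)"
      using AB(1,2) by (auto simp: decreasing_hull_def increasing_hull_def)
    ultimately show ?thesis
      using convex[of n] AB(5,6,7) by blast
  qed
  have F: "closedin T ?F" "decreasing_set G ?F"
    using x by (simp_all add: closedin_decreasing_hull_compact decreasing_set_hull)
  have H: "closedin T ?H" "increasing_set G ?H"
    using x by (simp_all add: closedin_increasing_hull_compact increasing_set_hull)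
  have Z: "closedin T (topspace T - O')"
    using O by blast
  have "?F \<inter> ?H \<inter> (topspace T - O') = {}"
    using assms(1) O by (auto simp: decreasing_hull_def increasing_hull_def dest: antisymD)
  then obtain U V where UV: "openin T U" "decreasing_set G U" "?F \<subseteq> U"
    "openin T V" "increasing_set G V" "?H \<subseteq> V" "U \<inter> V \<inter> (topspace T - O') = {}"
    using carry by (rule separation_along_exhaustion[OF K(1-3) F H Z])
  show thesis
  proof
    show "x \<in> U" "x \<in> V"
      using UV(3,6) xF xH by blast+
    show "U \<inter> V \<subseteq> O'"
      using UV(7) openin_subset[OF UV(1)] by blast
  qed (use UV in simp_all)
qed

end

section \<open>Utilities\<close>

text \<open>
  The bounds are required on the whole type, so that series of utilities converge everywhere.
\<close>
definition utility :: "'a topology \<Rightarrow> ('a \<times> 'a) set \<Rightarrow> ('a \<Rightarrow> real) \<Rightarrow> bool" where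
  "utility T G f \<longleftrightarrow> continuous_map T euclideanreal f \<and> (\<forall>x. 0 \<le> f x \<and> f x \<le> 1) \<and>
     (\<forall>x y. (x, y) \<in> G \<longrightarrow> f x \<le> f y)"

lemma utility_mono: "utility T G f \<Longrightarrow> (x, y) \<in> G \<Longrightarrow> f x \<le> f y"
  and utility_bounds: "utility T G f \<Longrightarrow> 0 \<le> f x" "utility T G f \<Longrightarrow> f x \<le> 1"
  and utility_continuous: "utility T G f \<Longrightarrow> continuous_map T euclideanreal f"
  by (auto simp: utility_def)

lemma dyadic_between:
  fixes a b :: real
  assumes "0 \<le> a" "a < b" "b \<le> 1"
  obtains r where "r \<in> dyadics \<inter> {0..1}" "a < r" "r < b"
proof -
  have "0 < (b - a) / 2" "1 < (2::real)" "0 < (a + b) / 2"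
    using assms by auto
  then obtain n q r where *: "real q / 2 ^ n < (a + b) / 2" "(a + b) / 2 < real r / 2 ^ n"
    "\<bar>real q / 2 ^ n - real r / 2 ^ n\<bar> < (b - a) / 2"
    by (rule padic_rational_approximation_straddle_pos)
  define t where "t = real q / 2 ^ n"
  have "t \<in> dyadics"
    unfolding t_def dyadics_def by auto
  moreover have "a < t" "t < b"
    using * assms unfolding t_def abs_less_iff by argo+
  ultimately show thesis
    using assms by (intro that[of t]) auto
qed

text \<open>
  The usual construction, carried out with decreasing sets: normality interpolates between a closed
  decreasing set and an open decreasing neighbourhood of it, which gives open decreasing sets \<open>S r\<close>
  indexed by the dyadic \<open>r\<close>, with a closed decreasing set between any two of them. The function
  \<open>x \<mapsto> Inf {r. x \<in> S r}\<close> is isotone because the \<open>S r\<close> are decreasing.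
\<close>
proposition ordered_Urysohn:
  assumes N: "normally_preordered T G" and G: "G \<subseteq> topspace T \<times> topspace T"
    and F: "closedin T F" "decreasing_set G F" and H: "closedin T H" "increasing_set G H"
    and FH: "F \<inter> H = {}"
  obtains f where "utility T G f" "\<And>x. x \<in> F \<Longrightarrow> f x = 0" "\<And>x. x \<in> H \<Longrightarrow> f x = 1"
proof -
  define R where "R A B \<longleftrightarrow> openin T A \<and> decreasing_set G A \<and> openin T B \<and> decreasing_set G B \<and>
      (\<exists>C. closedin T C \<and> decreasing_set G C \<and> A \<subseteq> C \<and> C \<subseteq> B)" for A B
  have interpolate: "\<exists>U. openin T U \<and> decreasing_set G U \<and> C \<subseteq> U \<and>
      (\<exists>D. closedin T D \<and> decreasing_set G D \<and> U \<subseteq> D \<and> D \<subseteq> B)"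
    if C: "closedin T C" "decreasing_set G C" and B: "openin T B" "decreasing_set G B" and CB: "C \<subseteq> B"
    for C B
  proof -
    have "C \<inter> (topspace T - B) = {}" "increasing_set G (topspace T - B)" "closedin T (topspace T - B)"
      using CB B G by (auto intro: increasing_set_complement)
    then obtain U V where UV: "openin T U" "decreasing_set G U" "C \<subseteq> U"
      "openin T V" "increasing_set G V" "topspace T - B \<subseteq> V" "U \<inter> V = {}"
      using N C unfolding normally_preordered_def by meson
    have "closedin T (topspace T - V)" "decreasing_set G (topspace T - V)"
      using UV G by (auto intro: decreasing_set_complement)
    moreover have "U \<subseteq> topspace T - V" "topspace T - V \<subseteq> B"
      using UV openin_subset[OF UV(1)] by blast+
    ultimately show ?thesis
      using UV by blast
  qed
  have "openin T (topspace T - H)" "decreasing_set G (topspace T - H)" "F \<subseteq> topspace T - H"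
    using H G FH closedin_subset[OF F(1)] by (auto intro: decreasing_set_complement)
  with interpolate[OF F] obtain U where "F \<subseteq> U" and base: "R U (topspace T - H)"
    unfolding R_def by meson
  have "\<exists>S :: real \<Rightarrow> 'a set. S 0 = U \<and> S 1 = topspace T - H \<and>
      (\<forall>r \<in> dyadics \<inter> {0..1}. \<forall>s \<in> dyadics \<inter> {0..1}. r < s \<longrightarrow> R (S r) (S s))"
    using base
  proof (rule recursion_on_dyadic_fractions)
    show "\<exists>C. R A C \<and> R C B" if "R A B" for A B
      using that interpolate unfolding R_def by meson
    show "R A C" if "R A B" "R B C" for A B C
      using that unfolding R_def by (meson subset_trans)
  qed
  then obtain S :: "real \<Rightarrow> 'a set" where S: "S 0 = U" "S 1 = topspace T - H"
    and SR: "\<And>r s. r \<in> dyadics \<inter> {0..1} \<Longrightarrow> s \<in> dyadics \<inter> {0..1} \<Longrightarrow> r < s \<Longrightarrow> R (S r) (S s)"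
    by blast
  have 01: "0 \<in> dyadics \<inter> {0..1::real}" "1 \<in> dyadics \<inter> {0..1::real}"
    by (force simp: dyadics_def)+
  have SO: "openin T (S r) \<and> decreasing_set G (S r)" if "r \<in> dyadics \<inter> {0..1}" for r
  proof (cases "r = 0")
    case True
    then show ?thesis
      using base S(1) by (auto simp: R_def)
  next
    case False
    then have "R (S 0) (S r)"
      using that 01 by (intro SR) auto
    then show ?thesis
      by (simp add: R_def)
  qed
  have Smono: "S r \<subseteq> S s" if "r \<in> dyadics \<inter> {0..1}" "s \<in> dyadics \<inter> {0..1}" "r \<le> s" for r s
  proof (cases "r = s")
    case False
    then have "R (S r) (S s)"
      using that by (intro SR) auto
    then show ?thesis
      by (auto simp: R_def)
  qed simp
  \<comment> \<open>Inserting \<open>1\<close> gives the value \<open>1\<close> to the points that lie in no \<open>S r\<close>.\<close>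
  define L where "L x = insert 1 {r \<in> dyadics \<inter> {0..1}. x \<in> S r}" for x
  define f where "f x = Inf (L x)" for x
  have L: "bdd_below (L x)" "L x \<noteq> {}" "\<And>r. r \<in> L x \<Longrightarrow> 0 \<le> r" for x
    by (auto simp: L_def bdd_below_def intro: exI[of _ 0])
  have f_le: "f x \<le> r" if "r \<in> L x" for x r
    unfolding f_def using that L(1) by (rule cInf_lower)
  have f_ge: "c \<le> f x" if "\<And>r. r \<in> L x \<Longrightarrow> c \<le> r" for x c
    unfolding f_def using L(2) that by (rule cInf_greatest)
  have f01: "0 \<le> f x" "f x \<le> 1" for x
    using f_ge[OF L(3)] f_le[of 1 x] by (auto simp: L_def)
  have f_less: "\<exists>r. r \<in> dyadics \<inter> {0..1} \<and> x \<in> S r \<and> r < c" if less: "f x < c" and "c \<le> 1" for x c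
  proof -
    obtain r where "r \<in> L x" "r < c"
      using less L(2)[of x] unfolding f_def by (meson cInf_lessD)
    then show ?thesis
      using \<open>c \<le> 1\<close> by (auto simp: L_def)
  qed
  have f_notin: "r \<le> f x" if "r \<in> dyadics \<inter> {0..1}" "x \<notin> S r" for x r
  proof (rule f_ge)
    fix s assume s: "s \<in> L x"
    show "r \<le> s"
    proof (rule ccontr)
      assume "\<not> r \<le> s"
      then have "x \<in> S s" "s \<in> dyadics \<inter> {0..1}"
        using s that(1) by (auto simp: L_def)
      then show False
        using Smono[of s r] that \<open>\<not> r \<le> s\<close> by auto
    qed
  qed
  have "openin T {x \<in> topspace T. f x < c}" for c
  proof (cases "c \<le> 1")
    case True
    have "{x \<in> topspace T. f x < c} = (\<Union>r \<in> {r \<in> dyadics \<inter> {0..1}. r < c}. S r)" (is "?l = ?r")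
    proof
      show "?l \<subseteq> ?r"
        using f_less True by fastforce
      have "x \<in> ?l" if r: "r \<in> dyadics \<inter> {0..1}" "r < c" "x \<in> S r" for x r
        using f_le[of r x] r SO[OF r(1)] openin_subset[of T "S r"] by (auto simp: L_def)
      then show "?r \<subseteq> ?l"
        by blast
    qed
    also have "openin T ?r"
      using SO by auto
    finally show ?thesis .
  next
    case False
    then have "f x < c" for x
      using f01(2)[of x] by simp
    then have "{x \<in> topspace T. f x < c} = topspace T"
      by simp
    then show ?thesis
      by simp
  qed
  moreover have "openin T {x \<in> topspace T. c < f x}" for c
  proof (subst openin_subopen, intro ballI)
    fix x assume x: "x \<in> {x \<in> topspace T. c < f x}"
    show "\<exists>W. openin T W \<and> x \<in> W \<and> W \<subseteq> {x \<in> topspace T. c < f x}"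
    proof (cases "0 \<le> c")
      case True
      obtain r where r: "r \<in> dyadics \<inter> {0..1}" "c < r" "r < f x"
        using dyadic_between[of c "f x"] True x f01(2) by auto
      obtain s where s: "s \<in> dyadics \<inter> {0..1}" "r < s" "s < f x"
        using dyadic_between[of r "f x"] r f01(2) by auto
      obtain C where C: "closedin T C" "S r \<subseteq> C" "C \<subseteq> S s"
        using SR[OF r(1) s(1,2)] by (auto simp: R_def)
      have "x \<notin> S s"
        using f_le[of s x] s by (auto simp: L_def)
      moreover have "c < f y" if "y \<notin> C" for y
      proof -
        have "y \<notin> S r"
          using that C(2) by blast
        with f_notin[OF r(1)] r(2) show ?thesis
          by (meson less_le_trans)
      qed
      ultimately show ?thesis
        using x C by (intro exI[of _ "topspace T - C"]) auto
    next
      case False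
      then have "c < f y" for y
        using f01(1)[of y] by simp
      then show ?thesis
        using x by (intro exI[of _ "topspace T"]) auto
    qed
  qed
  ultimately have "continuous_map T euclideanreal f"
    by (simp add: continuous_map_upper_lower_semicontinuous_lt)
  moreover have "f x \<le> f y" if xy: "(x, y) \<in> G" for x y
  proof (rule f_ge)
    fix r assume "r \<in> L y"
    then have "r \<in> L x"
      using xy SO unfolding L_def decreasing_set_def by blast
    then show "f x \<le> r"
      by (rule f_le)
  qed
  ultimately have "utility T G f"
    using f01 by (simp add: utility_def)
  moreover have "f x = 0" if "x \<in> F" for x
  proof -
    have "0 \<in> L x"
      using that \<open>F \<subseteq> U\<close> S(1) 01 by (auto simp: L_def)
    then show ?thesis
      using f_le[of 0 x] f01(1)[of x] by simp
  qed
  moreover have "f x = 1" if "x \<in> H" for x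
  proof -
    have "x \<notin> S 1"
      using that S(2) by simp
    then show ?thesis
      using f_notin[OF 01(2), of x] f01(2)[of x] by simp
  qed
  ultimately show thesis
    by (rule that)
qed


context closed_preordered_Hausdorff_space
begin

lemma closedin_point_hulls:
  assumes "x \<in> topspace T"
  shows "closedin T (decreasing_hull G {x})" "closedin T (increasing_hull G {x})"
    "x \<in> decreasing_hull G {x}" "x \<in> increasing_hull G {x}"
  using assms closedin_decreasing_hull_compact[of "{x}"] closedin_increasing_hull_compact[of "{x}"]
    subset_decreasing_hull[of "{x}"] subset_increasing_hull[of "{x}"]
  by simp_all

lemma utility_separates:
  assumes N: "normally_preordered T G"
    and xy: "x \<in> topspace T" "y \<in> topspace T" "(x, y) \<notin> G"
  obtains f where "utility T G f" "f y < f x"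
proof -
  have "decreasing_hull G {y} \<inter> increasing_hull G {x} = {}"
    using xy(3) graph_trans by (auto simp: decreasing_hull_def increasing_hull_def)
  then obtain f where f: "utility T G f" "\<And>z. z \<in> decreasing_hull G {y} \<Longrightarrow> f z = 0"
    "\<And>z. z \<in> increasing_hull G {x} \<Longrightarrow> f z = 1"
    using ordered_Urysohn[OF N graph_subset closedin_point_hulls(1)[OF xy(2)] decreasing_set_hull
        closedin_point_hulls(2)[OF xy(1)] increasing_set_hull] by metis
  then show thesis
    using closedin_point_hulls(4)[OF xy(1)] closedin_point_hulls(3)[OF xy(2)]
    by (intro that[of f]) simp_all
qed

text \<open>
  Ordered Urysohn functions for \<open>d {x}\<close> against the complement of \<open>U\<close>, and for the complement of \<open>V\<close>
  against \<open>i {x}\<close>.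
\<close>
lemma utility_neighbourhood_if_convex:
  assumes N: "normally_preordered T G"
    and U: "openin T U" "decreasing_set G U" "x \<in> U"
    and V: "openin T V" "increasing_set G V" "x \<in> V"
  obtains f g where "utility T G f" "utility T G g" "f x < 1" "0 < g x"
    "{z \<in> topspace T. f z < 1 \<and> 0 < g z} \<subseteq> U \<inter> V"
proof -
  have x: "x \<in> topspace T"
    using U openin_subset by blast
  note hulls = closedin_point_hulls[OF x]
  have "increasing_set G (topspace T - U)" "closedin T (topspace T - U)"
    using U graph_subset by (auto intro: increasing_set_complement)
  moreover have "decreasing_hull G {x} \<inter> (topspace T - U) = {}"
    using U by (auto simp: decreasing_hull_def decreasing_set_def)
  ultimately obtain f where f: "utility T G f" "\<And>z. z \<in> decreasing_hull G {x} \<Longrightarrow> f z = 0"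
      "\<And>z. z \<in> topspace T - U \<Longrightarrow> f z = 1"
    using ordered_Urysohn[OF N graph_subset hulls(1) decreasing_set_hull, of "topspace T - U"] by metis
  have "decreasing_set G (topspace T - V)" "closedin T (topspace T - V)"
    using V graph_subset by (auto intro: decreasing_set_complement)
  moreover have "(topspace T - V) \<inter> increasing_hull G {x} = {}"
    using V by (auto simp: increasing_hull_def increasing_set_def)
  ultimately obtain g where g: "utility T G g" "\<And>z. z \<in> topspace T - V \<Longrightarrow> g z = 0"
      "\<And>z. z \<in> increasing_hull G {x} \<Longrightarrow> g z = 1"
    using ordered_Urysohn[OF N graph_subset _ _ hulls(2) increasing_set_hull, of "topspace T - V"] by metis
  show thesis
  proof
    show "f x < 1" "0 < g x"
      using f(2) g(3) hulls(3,4) by simp_all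
    show "{z \<in> topspace T. f z < 1 \<and> 0 < g z} \<subseteq> U \<inter> V"
      using f(3) g(2) by force
  qed (use f g in simp_all)
qed

text \<open>
  By antisymmetry no point of \<open>S\<close> is both below and above \<open>x\<close>. Separating the two kinds of points
  splits \<open>S\<close> into two compact pieces, one disjoint from \<open>d {x}\<close> and one from \<open>i {x}\<close>; their hulls are
  closed, so a single Urysohn function handles each piece.
\<close>
lemma utilities_surround_compact:
  assumes N: "normally_preordered T G" and "antisym G"
    and x: "x \<in> topspace T" and S: "compactin T S" "x \<notin> S"
  obtains u v where "utility T G u" "utility T G v" "u x = 0" "v x = 1"
    "\<And>y. y \<in> S \<Longrightarrow> u y = 1 \<or> v y = 0"
proof -
  note hulls = closedin_point_hulls[OF x]
  have P: "compactin T (decreasing_hull G {x} \<inter> S)" "compactin T (increasing_hull G {x} \<inter> S)"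
    using hulls S by (simp_all add: closed_Int_compactin)
  have "disjnt (decreasing_hull G {x} \<inter> S) (increasing_hull G {x} \<inter> S)"
    using \<open>antisym G\<close> S(2)
    by (auto simp: disjnt_iff decreasing_hull_def increasing_hull_def dest: antisymD)
  then obtain A B where AB: "openin T A" "openin T B"
    "decreasing_hull G {x} \<inter> S \<subseteq> A" "increasing_hull G {x} \<inter> S \<subseteq> B" "disjnt A B"
    by (rule Hausdorff_space_compact_separation[OF Hausdorff P])
  have cpt: "compactin T ((topspace T - A) \<inter> S)" "compactin T ((topspace T - B) \<inter> S)"
    using AB S by (auto intro!: closed_Int_compactin)
  have "decreasing_hull G {x} \<inter> increasing_hull G ((topspace T - A) \<inter> S) = {}"
    using AB(3) graph_trans by (fastforce simp: decreasing_hull_def increasing_hull_def)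
  then obtain u where u: "utility T G u" "\<And>z. z \<in> decreasing_hull G {x} \<Longrightarrow> u z = 0"
      "\<And>z. z \<in> increasing_hull G ((topspace T - A) \<inter> S) \<Longrightarrow> u z = 1"
    using ordered_Urysohn[OF N graph_subset hulls(1) decreasing_set_hull
      closedin_increasing_hull_compact[OF cpt(1)] increasing_set_hull] by metis
  have "decreasing_hull G ((topspace T - B) \<inter> S) \<inter> increasing_hull G {x} = {}"
    using AB(4) graph_trans by (fastforce simp: decreasing_hull_def increasing_hull_def)
  then obtain v where v: "utility T G v" "\<And>z. z \<in> decreasing_hull G ((topspace T - B) \<inter> S) \<Longrightarrow> v z = 0"
      "\<And>z. z \<in> increasing_hull G {x} \<Longrightarrow> v z = 1"
    using ordered_Urysohn[OF N graph_subset closedin_decreasing_hull_compact[OF cpt(2)]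
      decreasing_set_hull hulls(2) increasing_set_hull] by metis
  show thesis
  proof
    show "u x = 0" "v x = 1"
      using u(2) v(3) hulls(3,4) by simp_all
    fix y assume "y \<in> S"
    then have "y \<in> topspace T"
      using compactin_subset_topspace[OF S(1)] by blast
    with \<open>y \<in> S\<close> have "y \<in> (topspace T - A) \<inter> S \<or> y \<in> (topspace T - B) \<inter> S"
      using AB(5) by (auto simp: disjnt_iff)
    moreover have "(topspace T - A) \<inter> S \<subseteq> increasing_hull G ((topspace T - A) \<inter> S)"
      "(topspace T - B) \<inter> S \<subseteq> decreasing_hull G ((topspace T - B) \<inter> S)"
      by (intro subset_increasing_hull subset_decreasing_hull; blast)+
    ultimately show "u y = 1 \<or> v y = 0"
      using u(3) v(2) by blast
  qed (use u v in simp_all)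
qed

text \<open>
  The relation \<open>f x \<le> f y\<close> is itself a closed preorder, so it contains the smallest one that contains
  \<open>R\<close>.
\<close>
lemma continuous_monotone_on_generator:
  assumes R: "R \<subseteq> G" "\<And>Q. closed_preorder T Q \<Longrightarrow> R \<subseteq> Q \<Longrightarrow> G \<subseteq> Q"
    and f: "continuous_map T euclideanreal f" "\<And>x y. (x, y) \<in> R \<Longrightarrow> f x \<le> f y"
    and xy: "(x, y) \<in> G"
  shows "f x \<le> f y"
proof -
  define Q where "Q = {z \<in> topspace (prod_topology T T). f (fst z) \<le> f (snd z)}"
  have "closedin (prod_topology T T) Q"
  proof -
    have "continuous_map (prod_topology T T) euclideanreal (\<lambda>z. f (fst z))"
      "continuous_map (prod_topology T T) euclideanreal (\<lambda>z. f (snd z))"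
      using continuous_map_compose[OF continuous_map_fst f(1)]
        continuous_map_compose[OF continuous_map_snd f(1)] by (simp_all add: o_def)
    then have "continuous_map (prod_topology T T) euclideanreal (\<lambda>z. f (snd z) - f (fst z))"
      by (intro continuous_map_diff)
    then have "closedin (prod_topology T T) {z \<in> topspace (prod_topology T T). f (snd z) - f (fst z) \<in> {0..}}"
      by (rule closedin_continuous_map_preimage) simp
    then show ?thesis
      by (simp add: Q_def)
  qed
  then have "closed_preorder T Q"
    unfolding closed_preorder_def preorder_on_def refl_on_def trans_def by (force simp: Q_def)
  moreover have "R \<subseteq> Q"
    using R(1) graph_subset f(2) by (auto simp: Q_def)
  ultimately have "(x, y) \<in> Q"
    using R(2) xy by blast
  then show ?thesis
    by (simp add: Q_def)
qed

lemma utility_neighbourhood_if_k_preserving: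
  assumes "antisym G" "locally_compact_space T" "second_countable T" "k_preserving T G"
    and O: "openin T O'" "x \<in> O'"
  obtains f g where "utility T G f" "utility T G g" "f x < 1" "0 < g x"
    "{z \<in> topspace T. f z < 1 \<and> 0 < g z} \<subseteq> O'"
proof -
  obtain U V where U: "openin T U" "decreasing_set G U" "x \<in> U"
    and V: "openin T V" "increasing_set G V" "x \<in> V" and UV: "U \<inter> V \<subseteq> O'"
    by (rule convex_neighbourhoods_if_k_preserving[OF assms])
  obtain f g where fg: "utility T G f" "utility T G g" "f x < 1" "0 < g x"
    "{z \<in> topspace T. f z < 1 \<and> 0 < g z} \<subseteq> U \<inter> V"
    by (rule utility_neighbourhood_if_convex
        [OF normally_preordered_if_locally_compact[OF assms(2,3)] U V])
  show thesis
    using fg(1-4) subset_trans[OF fg(5) UV] by (rule that)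
qed

text \<open>
  Let \<open>W\<close> be open with \<open>x \<in> W\<close>, contained in the given open set and in a compact set \<open>C\<close>, and let \<open>C'\<close>
  be compact containing \<open>C\<close> and the closure of \<open>R `` C\<close>. On the shell \<open>S = C' - W\<close> there are utilities with
  \<open>u = 1\<close> or \<open>v = 0\<close>, while \<open>u x = 0\<close> and \<open>v x = 1\<close>. The set where \<open>u < 1/2\<close> and \<open>v > 0\<close> may have
  parts outside \<open>C'\<close>, and these are removed by cutting \<open>v\<close> down there to \<open>min v k\<close>, where
  \<open>k = max 0 (2 u - 1)\<close> vanishes when \<open>u \<le> 1/2\<close>. On the shell \<open>v\<close> and \<open>min v k\<close> agree, so the result is
  continuous. An \<open>R\<close>-step that leaves \<open>W\<close> ends in the shell, where the two formulas agree, so the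
  result is monotone along \<open>R\<close>; hence it is isotone.
\<close>
lemma utility_neighbourhood_if_compactly_generated:
  assumes "antisym G" "locally_compact_space T" "second_countable T" "compactly_generated T G"
    and O: "openin T O'" "x \<in> O'"
  obtains f g where "utility T G f" "utility T G g" "f x < 1" "0 < g x"
    "{z \<in> topspace T. f z < 1 \<and> 0 < g z} \<subseteq> O'"
proof -
  obtain R where R: "R \<subseteq> G" "\<And>K. compactin T K \<Longrightarrow> compactin T (T closure_of (R `` K))"
    and least: "\<And>Q. closed_preorder T Q \<Longrightarrow> R \<subseteq> Q \<Longrightarrow> G \<subseteq> Q"
    using assms(4) unfolding compactly_generated_def by metis
  have x: "x \<in> topspace T"
    using O openin_subset by blast
  obtain U C where U: "openin T U" "compactin T C" "x \<in> U" "U \<subseteq> C"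
    using assms(2) x unfolding locally_compact_space_def by metis
  define W where "W = U \<inter> O'"
  have W: "openin T W" "x \<in> W" "W \<subseteq> C"
    using U O by (auto simp: W_def)
  define C' where "C' = C \<union> T closure_of (R `` C)"
  have C': "compactin T C'"
    unfolding C'_def using U(2) R(2) by (intro compactin_Un) auto
  have "R `` C \<subseteq> topspace T"
    using R(1) graph_subset by blast
  then have RC: "R `` C \<subseteq> C'"
    using closure_of_subset[of "R `` C" T] by (auto simp: C'_def)
  define S where "S = (topspace T - W) \<inter> C'"
  have S: "compactin T S" "x \<notin> S"
    unfolding S_def using W C' by (auto intro!: closed_Int_compactin)
  obtain u v where u: "utility T G u" and v: "utility T G v" and uv: "u x = 0" "v x = 1"
    and uvS: "\<And>y. y \<in> S \<Longrightarrow> u y = 1 \<or> v y = 0"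
    using utilities_surround_compact
      [OF normally_preordered_if_locally_compact[OF assms(2,3)] assms(1) x S] by metis
  define f where "f y = min 1 (2 * u y)" for y
  define k where "k y = max 0 (2 * u y - 1)" for y
  define g where "g y = (if y \<in> W then v y else min (v y) (k y))" for y
  have k_01: "0 \<le> k y" "k y \<le> 1" for y
    using utility_bounds[OF u, of y] by (auto simp: k_def)
  have f: "utility T G f"
    unfolding utility_def f_def
  proof (intro conjI allI impI)
    show "continuous_map T euclideanreal (\<lambda>y. min 1 (2 * u y))"
      using utility_continuous[OF u] by (intro continuous_intros) auto
    show "min 1 (2 * u y) \<le> min 1 (2 * u z)" if "(y, z) \<in> G" for y z
      using utility_mono[OF u that] by auto
  qed (use utility_bounds[OF u] in auto)
  have agree: "v y = min (v y) (k y)" if "y \<in> S" for y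
    using uvS[OF that] utility_bounds[OF v, of y] k_01[of y] by (auto simp: k_def)
  have k_cont: "continuous_map T euclideanreal (\<lambda>y. min (v y) (k y))"
    unfolding k_def using utility_continuous[OF u] utility_continuous[OF v]
    by (intro continuous_intros) auto
  have g_cont: "continuous_map T euclideanreal g"
    unfolding g_def
  proof (rule continuous_map_cases)
    show "continuous_map (subtopology T (T closure_of {y. y \<in> W})) euclideanreal v"
      using utility_continuous[OF v] by (rule continuous_map_from_subtopology)
    show "continuous_map (subtopology T (T closure_of {y. y \<notin> W})) euclideanreal (\<lambda>y. min (v y) (k y))"
      using k_cont by (rule continuous_map_from_subtopology)
    fix y assume y: "y \<in> T frontier_of {y. y \<in> W}"
    have "T closure_of W \<subseteq> C'"
      using W(3) compactin_imp_closedin[OF Hausdorff C'] by (intro closure_of_minimal) (auto simp: C'_def)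
    moreover have "T interior_of W = W"
      using W(1) by (rule interior_of_openin)
    ultimately have "y \<in> S"
      using y closure_of_subset_topspace[of T W] by (auto simp: S_def frontier_of_def)
    then show "v y = min (v y) (k y)"
      by (rule agree)
  qed
  \<comment> \<open>Only a step that leaves \<open>W\<close> is delicate: there the smaller formula takes over at the larger point.\<close>
  have g_R: "g y \<le> g z" if yz: "(y, z) \<in> R" for y z
  proof -
    have "v y \<le> v z" "u y \<le> u z"
      using R(1) yz utility_mono[OF u] utility_mono[OF v] by blast+
    then have mono: "v y \<le> v z" "min (v y) (k y) \<le> min (v z) (k z)"
      by (auto simp: k_def)
    show ?thesis
    proof (cases "y \<in> W \<and> z \<notin> W")
      case True
      then have "z \<in> S"
        using yz W(3) RC R(1) graph_subset by (auto simp: S_def)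
      then show ?thesis
        using True mono agree by (simp add: g_def)
    next
      case False
      then show ?thesis
        using mono by (auto simp: g_def)
    qed
  qed
  have g: "utility T G g"
    unfolding utility_def
  proof (intro conjI allI impI)
    show "g y \<le> g z" if "(y, z) \<in> G" for y z
      using R(1) least g_cont g_R that by (rule continuous_monotone_on_generator)
  qed (use g_cont k_01 utility_bounds[OF v] in \<open>auto simp: g_def min_le_iff_disj\<close>)
  show thesis
  proof
    show "f x < 1" "0 < g x"
      using uv W(2) by (simp_all add: f_def g_def)
    have "y \<in> W" if y: "f y < 1" "0 < g y" for y
      using y by (auto simp: f_def g_def k_def split: if_splits)
    then show "{z \<in> topspace T. f z < 1 \<and> 0 < g z} \<subseteq> O'"
      by (auto simp: W_def)
  qed (use f g in simp_all)
qed

end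


section \<open>From countably many utilities to a quasi-metric\<close>

lemma continuous_map_weighted_series:
  fixes h :: "nat \<Rightarrow> 'a \<Rightarrow> real"
  assumes "\<And>n. continuous_map T euclideanreal (h n)" "\<And>n x. 0 \<le> h n x \<and> h n x \<le> 1"
  shows "continuous_map T euclideanreal (\<lambda>x. \<Sum>n. (1/2) ^ n * h n x)"
proof -
  have "uniform_limit (topspace T) (\<lambda>n x. \<Sum>i<n. (1/2) ^ i * h i x) (\<lambda>x. \<Sum>n. (1/2) ^ n * h n x) sequentially"
    using assms(2) by (intro Weierstrass_m_test[where M = "\<lambda>n. (1/2) ^ n"])
      (auto simp: abs_mult mult_left_le)
  from uniform_limitD[OF this] have "\<forall>\<^sub>F n in sequentially. \<forall>x\<in>topspace T.
      (\<Sum>n. (1/2) ^ n * h n x) \<in> UNIV \<and> dist (\<Sum>i<n. (1/2) ^ i * h i x) (\<Sum>n. (1/2) ^ n * h n x) < e"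
    if "0 < e" for e
    by (rule eventually_mono) (use that in simp_all)
  moreover have "continuous_map T euclideanreal (\<lambda>x. \<Sum>i<n. (1/2) ^ i * h i x)" for n
    using assms(1) by (intro continuous_intros) auto
  ultimately have "continuous_map T Met_TC.mtopology (\<lambda>x. \<Sum>n. (1/2) ^ n * h n x)"
    by (intro Met_TC.continuous_map_uniform_limit[where F = sequentially
          and f = "\<lambda>n x. \<Sum>i<n. (1/2) ^ i * h i x"]) auto
  then show ?thesis
    by simp
qed


text \<open>
  For every pair of basic open sets one utility (or pair of utilities) is chosen that works uniformly on
  the pair, if there is any. Every instance of separation already holds uniformly on suitable basic
  sets, because the conditions are strict inequalities between continuous functions.
\<close>
lemma countably_many_utilities:
  assumes "second_countable T"
    and sep: "\<And>x y. \<lbrakk>x \<in> topspace T; y \<in> topspace T; (x, y) \<notin> G\<rbrakk> \<Longrightarrow> \<exists>f. utility T G f \<and> f y < f x"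
    and nbhd: "\<And>S x. \<lbrakk>openin T S; x \<in> S\<rbrakk> \<Longrightarrow> \<exists>f g. utility T G f \<and> utility T G g \<and> f x < 1 \<and> 0 < g x \<and>
        {z \<in> topspace T. f z < 1 \<and> 0 < g z} \<subseteq> S"
  obtains F :: "nat \<Rightarrow> 'a \<Rightarrow> real" where "\<And>n. utility T G (F n)"
    "\<And>x y. \<lbrakk>x \<in> topspace T; y \<in> topspace T; (x, y) \<notin> G\<rbrakk> \<Longrightarrow> \<exists>n. F n y < F n x"
    "\<And>S x. \<lbrakk>openin T S; x \<in> S\<rbrakk> \<Longrightarrow> \<exists>m n. F m x < 1 \<and> 0 < F n x \<and>
        {z \<in> topspace T. F m z < 1 \<and> 0 < F n z} \<subseteq> S"
proof -
  obtain \<B> where \<B>: "countable \<B>" and \<B>_open: "\<And>B. B \<in> \<B> \<Longrightarrow> openin T B"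
    and base: "\<And>S x. openin T S \<Longrightarrow> x \<in> S \<Longrightarrow> \<exists>B\<in>\<B>. x \<in> B \<and> B \<subseteq> S"
    using assms(1) unfolding second_countable_def by metis
  have upper: "openin T {z \<in> topspace T. c < f z}" and lower: "openin T {z \<in> topspace T. f z < c}"
    if "utility T G f" for f c
    using utility_continuous[OF that] by (simp_all add: continuous_map_upper_lower_semicontinuous_lt)
  define \<Phi> where "\<Phi> B B' f \<longleftrightarrow> utility T G f \<and> (\<forall>x\<in>B. \<forall>y\<in>B'. f y < f x)" for B B' f
  define \<Psi> where "\<Psi> B B' f g \<longleftrightarrow> utility T G f \<and> utility T G g \<and> (\<forall>z\<in>B. f z < 1 \<and> 0 < g z) \<and>
      {z \<in> topspace T. f z < 1 \<and> 0 < g z} \<subseteq> B'" for B B' f g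
  define \<phi> where "\<phi> = (\<lambda>(B, B'). SOME f. \<Phi> B B' f)"
  define \<psi> where "\<psi> = (\<lambda>(B, B'). SOME h. \<Psi> B B' (fst h) (snd h))"
  define \<C> where "\<C> = (insert (\<lambda>_. 0) (\<phi> ` (\<B> \<times> \<B>) \<union> (fst \<circ> \<psi>) ` (\<B> \<times> \<B>) \<union> (snd \<circ> \<psi>) ` (\<B> \<times> \<B>)))
      \<inter> Collect (utility T G)"
  have \<phi>: "\<Phi> B B' (\<phi> (B, B'))" if "\<Phi> B B' f" for B B' f
    unfolding \<phi>_def prod.case using that by (rule someI[where P = "\<Phi> B B'"])
  have \<psi>: "\<Psi> B B' (fst (\<psi> (B, B'))) (snd (\<psi> (B, B')))" if "\<Psi> B B' f g" for B B' f g
  proof -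
    have "\<Psi> B B' (fst (f, g)) (snd (f, g))"
      unfolding fst_conv snd_conv by (rule that)
    then show ?thesis
      unfolding \<psi>_def prod.case by (rule someI[of "\<lambda>h. \<Psi> B B' (fst h) (snd h)"])
  qed
  have "utility T G (\<lambda>_. 0)"
    by (simp add: utility_def)
  then have ne: "\<C> \<noteq> {}"
    unfolding \<C>_def by blast
  have cnt: "countable \<C>"
    unfolding \<C>_def using \<B> by (intro countable_Int1) auto
  define F where "F = from_nat_into \<C>"
  have F: "range F = \<C>"
    unfolding F_def using ne cnt by (rule range_from_nat_into)
  show thesis
  proof
    have "F n \<in> \<C>" for n
      using F by blast
    then show "utility T G (F n)" for n
      unfolding \<C>_def by blast
  next
    fix x y assume xy: "x \<in> topspace T" "y \<in> topspace T" "(x, y) \<notin> G"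
    then obtain f where f: "utility T G f" "f y < f x"
      using sep by blast
    then obtain c where c: "f y < c" "c < f x"
      using dense by blast
    obtain B where B: "B \<in> \<B>" "x \<in> B" "B \<subseteq> {z \<in> topspace T. c < f z}"
      using base[OF upper[OF f(1)], of x c] xy c by auto
    obtain B' where B': "B' \<in> \<B>" "y \<in> B'" "B' \<subseteq> {z \<in> topspace T. f z < c}"
      using base[OF lower[OF f(1)], of y c] xy c by auto
    have "\<Phi> B B' f"
      using f(1) B(3) B'(3) unfolding \<Phi>_def by fastforce
    then have \<Phi>: "\<Phi> B B' (\<phi> (B, B'))"
      by (rule \<phi>)
    then have "\<phi> (B, B') \<in> \<C>"
      using B(1) B'(1) unfolding \<C>_def \<Phi>_def by blast
    then obtain n where "F n = \<phi> (B, B')"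
      using F by (metis rangeE)
    then show "\<exists>n. F n y < F n x"
      using \<Phi> B(2) B'(2) unfolding \<Phi>_def by metis
  next
    fix S x assume S: "openin T S" "x \<in> S"
    obtain B' where B': "B' \<in> \<B>" "x \<in> B'" "B' \<subseteq> S"
      using base[OF S] by blast
    obtain f g where fg: "utility T G f" "utility T G g" "f x < 1" "0 < g x"
        "{z \<in> topspace T. f z < 1 \<and> 0 < g z} \<subseteq> B'"
      using nbhd[OF \<B>_open[OF B'(1)] B'(2)] by metis
    have "openin T ({z \<in> topspace T. f z < 1} \<inter> {z \<in> topspace T. 0 < g z})"
      using fg(1,2) upper lower by (intro openin_Int)
    moreover have "x \<in> {z \<in> topspace T. f z < 1} \<inter> {z \<in> topspace T. 0 < g z}"
      using fg(3,4) S openin_subset[OF S(1)] by auto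
    ultimately obtain B where B: "B \<in> \<B>" "x \<in> B"
        "B \<subseteq> {z \<in> topspace T. f z < 1} \<inter> {z \<in> topspace T. 0 < g z}"
      using base by meson
    have "\<Psi> B B' f g"
      using fg(1,2,5) B(3) unfolding \<Psi>_def by blast
    then have \<Psi>: "\<Psi> B B' (fst (\<psi> (B, B'))) (snd (\<psi> (B, B')))"
      by (rule \<psi>)
    have "fst (\<psi> (B, B')) \<in> \<C>" "snd (\<psi> (B, B')) \<in> \<C>"
      using \<Psi> B(1) B'(1) unfolding \<C>_def \<Psi>_def by (auto simp: image_iff)
    then obtain m n where "F m = fst (\<psi> (B, B'))" "F n = snd (\<psi> (B, B'))"
      using F by (metis rangeE)
    moreover have "fst (\<psi> (B, B')) x < 1" "0 < snd (\<psi> (B, B')) x"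
        "{z \<in> topspace T. fst (\<psi> (B, B')) z < 1 \<and> 0 < snd (\<psi> (B, B')) z} \<subseteq> S"
      using \<Psi> B(2) B'(3) unfolding \<Psi>_def by blast+
    ultimately show "\<exists>m n. F m x < 1 \<and> 0 < F n x \<and> {z \<in> topspace T. F m z < 1 \<and> 0 < F n z} \<subseteq> S"
      by metis
  qed
qed

definition weighted_excess :: "(nat \<Rightarrow> 'a \<Rightarrow> real) \<Rightarrow> 'a \<Rightarrow> 'a \<Rightarrow> real" where
  "weighted_excess F x y = (\<Sum>n. (1/2) ^ n * max 0 (F n x - F n y))"

context
  fixes T :: "'a topology" and G and F :: "nat \<Rightarrow> 'a \<Rightarrow> real"
  assumes utilities: "\<And>n. utility T G (F n)"
begin

lemma excess_bounds: "0 \<le> max 0 (F n x - F n y) \<and> max 0 (F n x - F n y) \<le> 1"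
  using utility_bounds[OF utilities, of n x] utility_bounds[OF utilities, of n y] by linarith

lemma excess_summable: "summable (\<lambda>n. (1/2) ^ n * max 0 (F n x - F n y))"
proof (rule summable_comparison_test)
  show "\<exists>N. \<forall>n\<ge>N. norm ((1/2) ^ n * max 0 (F n x - F n y)) \<le> (1/2) ^ n"
    using excess_bounds by (auto simp: abs_mult mult_left_le)
qed simp

lemma excess_term_le: "(1/2) ^ n * max 0 (F n x - F n y) \<le> weighted_excess F x y"
  using sum_le_suminf[OF excess_summable, of "{n}" x y] by (simp add: weighted_excess_def)

lemma weighted_excess_eq_0_iff: "weighted_excess F x y = 0 \<longleftrightarrow> (\<forall>n. F n x \<le> F n y)"
proof
  assume 0: "weighted_excess F x y = 0"
  show "\<forall>n. F n x \<le> F n y"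
  proof
    fix n
    show "F n x \<le> F n y"
    proof (rule ccontr)
      assume "\<not> F n x \<le> F n y"
      then have "0 < (1/2) ^ n * max 0 (F n x - F n y)"
        by simp
      then show False
        using excess_term_le[of n x y] 0 by simp
    qed
  qed
next
  assume "\<forall>n. F n x \<le> F n y"
  then have "max 0 (F n x - F n y) = 0" for n
    by simp
  then show "weighted_excess F x y = 0"
    by (simp add: weighted_excess_def)
qed

lemma weighted_excess_quasi_pseudo_metric: "quasi_pseudo_metric_on E (weighted_excess F)"
  unfolding quasi_pseudo_metric_on_def
proof (intro conjI ballI allI)
  show "0 \<le> weighted_excess F x y" for x y
    unfolding weighted_excess_def using excess_summable by (rule suminf_nonneg) simp
  show "weighted_excess F x x = 0" for x
    by (simp add: weighted_excess_eq_0_iff)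
  fix x y z
  have "weighted_excess F x z \<le>
      (\<Sum>n. (1/2) ^ n * max 0 (F n x - F n y) + (1/2) ^ n * max 0 (F n y - F n z))"
    unfolding weighted_excess_def
  proof (rule suminf_le)
    show "(1/2) ^ n * max 0 (F n x - F n z) \<le>
        (1/2) ^ n * max 0 (F n x - F n y) + (1/2) ^ n * max 0 (F n y - F n z)" for n
      unfolding distrib_left[symmetric] by (intro mult_left_mono) auto
  qed (intro summable_add excess_summable)+
  also have "\<dots> = weighted_excess F x y + weighted_excess F y z"
    unfolding weighted_excess_def by (intro suminf_add[symmetric] excess_summable)
  finally show "weighted_excess F x z \<le> weighted_excess F x y + weighted_excess F y z" .
qed

lemma continuous_map_weighted_excess:
  "continuous_map T euclideanreal (\<lambda>y. weighted_excess F x y)"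
  "continuous_map T euclideanreal (\<lambda>y. weighted_excess F y x)"
  unfolding weighted_excess_def
  by (rule continuous_map_weighted_series;
      intro excess_bounds continuous_intros utility_continuous[OF utilities])+

end

text \<open>
  Balls are open because \<open>p\<close> is a uniform limit of continuous functions of either argument. Conversely,
  if \<open>max (p x y) (p y x)\<close> is below the two weighted gaps \<open>2\<^sup>-\<^sup>m (1 - F m x)\<close> and \<open>2\<^sup>-\<^sup>n F n x\<close>, then \<open>F m\<close> cannot
  rise to \<open>1\<close> and \<open>F n\<close> cannot fall to \<open>0\<close> on the way from \<open>x\<close> to \<open>y\<close>.
\<close>
proposition quasi_metric_from_utilities:
  fixes T :: "'a topology" and F :: "nat \<Rightarrow> 'a \<Rightarrow> real" and p :: "'a \<Rightarrow> 'a \<Rightarrow> real"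
  assumes T2: "T2_ordered T G"
    and F: "\<And>n. utility T G (F n)"
    and sep: "\<And>x y. \<lbrakk>x \<in> topspace T; y \<in> topspace T; (x, y) \<notin> G\<rbrakk> \<Longrightarrow> \<exists>n. F n y < F n x"
    and nbhd: "\<And>S x. \<lbrakk>openin T S; x \<in> S\<rbrakk> \<Longrightarrow> \<exists>m n. F m x < 1 \<and> 0 < F n x \<and>
        {z \<in> topspace T. F m z < 1 \<and> 0 < F n z} \<subseteq> S"
  defines "p \<equiv> weighted_excess F"
  shows "Albert_quasi_metric_on (topspace T) p"
    "G = {(x, y) \<in> topspace T \<times> topspace T. p x y = 0}"
    "T = Metric_space.mtopology (topspace T) (join_dist p (conjugate p))"
proof -
  have G: "G \<subseteq> topspace T \<times> topspace T" "refl_on (topspace T) G" "antisym G"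
    using T2 by (auto simp: T2_ordered_def partial_order_on_def preorder_on_def)
  have p0: "p x y = 0 \<longleftrightarrow> (x, y) \<in> G" if "x \<in> topspace T" "y \<in> topspace T" for x y
    unfolding p_def weighted_excess_eq_0_iff[where F = F, OF F]
    using sep[OF that] utility_mono[OF F, of x y] by (meson not_less)
  then show "G = {(x, y) \<in> topspace T \<times> topspace T. p x y = 0}"
    using G(1) by auto
  show Albert: "Albert_quasi_metric_on (topspace T) p"
    unfolding Albert_quasi_metric_on_def
  proof (intro conjI ballI)
    show "quasi_pseudo_metric_on (topspace T) p"
      unfolding p_def using F by (rule weighted_excess_quasi_pseudo_metric)
    show "(p x y = 0 \<and> p y x = 0) = (x = y)" if "x \<in> topspace T" "y \<in> topspace T" for x y
      using p0[of x y] p0[of y x] that G(2,3) by (auto simp: refl_on_def dest: antisymD)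
  qed
  define d where "d = join_dist p (conjugate p)"
  interpret d: Metric_space "topspace T" d
    unfolding d_def using Albert by (rule Metric_space_join_dist_conjugate)
  have d_eq: "d x y = max (p x y) (p y x)" for x y
    by (simp add: d_def join_dist_def conjugate_def)
  have "openin T S \<longleftrightarrow> openin d.mtopology S" for S
  proof
    assume S: "openin T S"
    show "openin d.mtopology S"
      unfolding d.openin_mtopology
    proof (intro conjI allI impI)
      show "S \<subseteq> topspace T"
        using S by (rule openin_subset)
      fix x assume "x \<in> S"
      then obtain m n where mn: "F m x < 1" "0 < F n x" "{z \<in> topspace T. F m z < 1 \<and> 0 < F n z} \<subseteq> S"
        using nbhd[OF S] by metis
      define r where "r = min ((1/2) ^ m * (1 - F m x)) ((1/2) ^ n * F n x)"
      have "r > 0"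
        using mn by (simp add: r_def)
      moreover have "y \<in> S" if y: "y \<in> d.mball x r" for y
      proof -
        have "p x y < r" "p y x < r" "y \<in> topspace T"
          using y by (auto simp: d.mball_def d_eq)
        moreover have "r \<le> (1/2) ^ m * (1 - F m x)" "r \<le> (1/2) ^ n * F n x"
          by (simp_all add: r_def)
        ultimately have "(1/2) ^ m * max 0 (F m y - F m x) < (1/2) ^ m * (1 - F m x)"
          "(1/2) ^ n * max 0 (F n x - F n y) < (1/2) ^ n * F n x"
          using excess_term_le[where F = F, OF F, of m y x] excess_term_le[where F = F, OF F, of n x y]
          unfolding p_def by linarith+
        note less = this
        have "max 0 (F m y - F m x) < 1 - F m x" "max 0 (F n x - F n y) < F n x"
          using mult_left_less_imp_less[OF less(1)] mult_left_less_imp_less[OF less(2)] by simp_all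
        then have "F m y < 1" "0 < F n y"
          by simp_all
        then show ?thesis
          using mn(3) \<open>y \<in> topspace T\<close> by blast
      qed
      ultimately show "\<exists>r>0. d.mball x r \<subseteq> S"
        by blast
    qed
  next
    assume S: "openin d.mtopology S"
    show "openin T S"
    proof (subst openin_subopen, intro ballI)
      fix x assume "x \<in> S"
      then obtain r where r: "r > 0" "d.mball x r \<subseteq> S" and x: "x \<in> topspace T"
        using S unfolding d.openin_mtopology by blast
      have "continuous_map T euclideanreal (d x)"
        unfolding d_eq p_def by (intro continuous_intros continuous_map_weighted_excess[where F = F, OF F])
      then have "openin T {y \<in> topspace T. d x y < r}"
        by (simp add: continuous_map_upper_lower_semicontinuous_lt)
      moreover have "{y \<in> topspace T. d x y < r} = d.mball x r"
        using x by (auto simp: d.mball_def)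
      ultimately show "\<exists>W. openin T W \<and> x \<in> W \<and> W \<subseteq> S"
        using r x by (intro exI[of _ "d.mball x r"]) simp
    qed
  qed
  then show "T = Metric_space.mtopology (topspace T) (join_dist p (conjugate p))"
    unfolding d_def[symmetric] by (simp add: topology_eq)
qed

theorem theorem5p1:
  fixes T :: "'a topology" and G :: "('a \<times> 'a) set"
  assumes "T2_ordered T G"
    and "second_countable T"
    and "locally_compact_space T"
    and "k_preserving T G \<or> compactly_generated T G"
  shows "\<exists>p :: 'a \<Rightarrow> 'a \<Rightarrow> real.
           quasi_pseudo_metric_on (topspace T) p \<and>
           Albert_quasi_metric_on (topspace T) p \<and>
           T = Metric_space.mtopology (topspace T) (join_dist p (conjugate p)) \<and>
           G = {(x, y) \<in> topspace T \<times> topspace T. p x y = 0}"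
proof -
  interpret closed_preordered_Hausdorff_space T G
    using assms(1) T2_ordered_imp_Hausdorff[OF assms(1)]
    by unfold_locales (auto simp: T2_ordered_def closed_preorder_def partial_order_on_def)
  have antisym: "antisym G"
    using assms(1) by (simp add: T2_ordered_def partial_order_on_def)
  have sep: "\<exists>f. utility T G f \<and> f y < f x"
    if xy: "x \<in> topspace T" "y \<in> topspace T" "(x, y) \<notin> G" for x y
  proof -
    obtain f where "utility T G f" "f y < f x"
      using xy by (rule utility_separates[OF normally_preordered_if_locally_compact[OF assms(3,2)]])
    then show ?thesis
      by (intro exI conjI)
  qed
  have nbhd: "\<exists>f g. utility T G f \<and> utility T G g \<and> f x < 1 \<and> 0 < g x \<and>
      {z \<in> topspace T. f z < 1 \<and> 0 < g z} \<subseteq> S" if S: "openin T S" "x \<in> S" for S x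
    using assms(4)
  proof
    assume kp: "k_preserving T G"
    obtain f g where "utility T G f" "utility T G g" "f x < 1" "0 < g x"
        "{z \<in> topspace T. f z < 1 \<and> 0 < g z} \<subseteq> S"
      using kp S by (rule utility_neighbourhood_if_k_preserving[OF antisym assms(3,2)])
    then show ?thesis
      by (intro exI conjI)
  next
    assume cg: "compactly_generated T G"
    obtain f g where "utility T G f" "utility T G g" "f x < 1" "0 < g x"
        "{z \<in> topspace T. f z < 1 \<and> 0 < g z} \<subseteq> S"
      using cg S by (rule utility_neighbourhood_if_compactly_generated[OF antisym assms(3,2)])
    then show ?thesis
      by (intro exI conjI)
  qed
  show ?thesis
    using assms(2) sep nbhd
  proof (rule countably_many_utilities)
    fix F :: "nat \<Rightarrow> 'a \<Rightarrow> real"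
    assume F: "\<And>n. utility T G (F n)"
      "\<And>x y. \<lbrakk>x \<in> topspace T; y \<in> topspace T; (x, y) \<notin> G\<rbrakk> \<Longrightarrow> \<exists>n. F n y < F n x"
      "\<And>S x. \<lbrakk>openin T S; x \<in> S\<rbrakk> \<Longrightarrow> \<exists>m n. F m x < 1 \<and> 0 < F n x \<and>
          {z \<in> topspace T. F m z < 1 \<and> 0 < F n z} \<subseteq> S"
    have Albert: "Albert_quasi_metric_on (topspace T) (weighted_excess F)"
      using assms(1) F by (rule quasi_metric_from_utilities)
    have graph: "G = {(x, y) \<in> topspace T \<times> topspace T. weighted_excess F x y = 0}"
      using assms(1) F by (rule quasi_metric_from_utilities)
    have top: "T = Metric_space.mtopology (topspace T)
        (join_dist (weighted_excess F) (conjugate (weighted_excess F)))"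
      using assms(1) F by (rule quasi_metric_from_utilities)
    have "quasi_pseudo_metric_on (topspace T) (weighted_excess F)"
      using Albert by (simp add: Albert_quasi_metric_on_def)
    then show ?thesis
      using Albert top graph by (intro exI[of _ "weighted_excess F"] conjI)
  qed
qed

end
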